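(* Let $K$ be a field, $S=K[x_1,\dots,x_n]$ with $n$ odd, and let $Q$ and $Q'$ be two irreducible monomial ideals of $S$ such that $\sqrt{Q}=(x_1,\dots,x_t)$ and $\sqrt{Q'}=(x_{t+1},\dots,x_n)$, where $1\leq t<n$. Then $$\operatorname{sdepth}(Q\cap Q')=\left\lceil\frac{n}{2}\right\rceil.$$
   Context: Let $S=K[x_1,\dots,x_n]$ be a polynomial ring over a field $K$ with its standard $\mathbb{Z}^n$-grading, and let $M$ be a nonzero finitely generated $\mathbb{Z}^n$-graded $S$-module. For a homogeneous element $w\in M$ and a subset $Z\subset\{x_1,\dots,x_n\}$, $wK[Z]$ denotes the $K$-subspace of $M$ generated by all elements $wv$ with $v$ a monomial in $K[Z]$. It is called a Stanley space of dimension $|Z|$ if it is a free $K[Z]$-module. A Stanley decomposition of $M$ is a presentation of the $K$-vector space $M$ as a finite direct sum of Stanley spaces $\mathcal{D}: M=\bigoplus_{i=1}^s u_iK[Z_i]$, and $\operatorname{sdepth}\mathcal{D}=\min\{|Z_i| : i=1,\dots,s\}$. The Stanley depth of $M$ is $\operatorname{sdepth}(M)=\max\{\operatorname{sdepth}\mathcal{D} : \mathcal{D}\text{ a Stanley decomposition of } M\}$. A monomial ideal is irreducible if it is not a proper intersection of two larger monomial ideals, equivalently if it is generated by powers of some of the variables. *)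

theory Defs
  imports
    Complex_Main
    "HOL-Library.Poly_Mapping"
    "HOL-Algebra.Ideal"
begin

section \<open>Polynomial rings and monomial ideals\<close>

text \<open>A polynomial maps exponent vectors to coefficients. The ambient type has the
  variables $x_i$ for all natural numbers $i$; the ring $K[Z]$ on a set \<open>Z\<close> of (indices of)
  variables is carved out as a carrier set, so that $S = K[x_1,\dots,x_n]$ is
  \<open>poly_ring {1..n}\<close>.\<close>

type_synonym 'k mpoly = "(nat \<Rightarrow>\<^sub>0 nat) \<Rightarrow>\<^sub>0 'k"

definition mono :: "(nat \<Rightarrow>\<^sub>0 nat) \<Rightarrow> 'k::field mpoly" where
  "mono m = Poly_Mapping.single m 1"

definition X :: "nat \<Rightarrow> 'k::field mpoly" where
  "X i = mono (Poly_Mapping.single i 1)"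

definition const :: "'k::field \<Rightarrow> 'k mpoly" where
  "const c = Poly_Mapping.single 0 c"

definition poly_ring :: "nat set \<Rightarrow> 'k::field mpoly ring" where
  "poly_ring Z =
     \<lparr>carrier = {p. \<forall>m\<in>Poly_Mapping.keys p. Poly_Mapping.keys m \<subseteq> Z},
      mult = (*), one = 1, zero = 0, add = (+)\<rparr>"

definition radical :: "('a, 'b) ring_scheme \<Rightarrow> 'a set \<Rightarrow> 'a set" where
  "radical R I = {f \<in> carrier R. \<exists>k::nat. f [^]\<^bsub>R\<^esub> k \<in> I}"

definition monomial_ideal :: "nat \<Rightarrow> 'k::field mpoly set \<Rightarrow> bool" where
  "monomial_ideal n I \<longleftrightarrow>
     (\<exists>A. (\<forall>m\<in>A. Poly_Mapping.keys m \<subseteq> {1..n}) \<and> I = Idl\<^bsub>poly_ring {1..n}\<^esub> (mono ` A))"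

definition irreducible_monomial_ideal :: "nat \<Rightarrow> 'k::field mpoly set \<Rightarrow> bool" where
  "irreducible_monomial_ideal n I \<longleftrightarrow>
     monomial_ideal n I \<and>
     \<not> (\<exists>J J'. monomial_ideal n J \<and> monomial_ideal n J' \<and> I \<subset> J \<and> I \<subset> J' \<and> I = J \<inter> J')"

section \<open>Stanley depth\<close>

text \<open>A graded module over $S$ is given by its underlying set \<open>M\<close>, the action \<open>act\<close> of
  polynomials, and the family \<open>G\<close> of its graded components.\<close>

definition homogeneous :: "('d \<Rightarrow> 'm set) \<Rightarrow> 'm \<Rightarrow> bool" where
  "homogeneous G w \<longleftrightarrow> (\<exists>a. w \<in> G a)"

text \<open>$wK[Z]$, as the $K$-linear span of the elements $wv$ with $v$ a monomial in $K[Z]$\<close>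

definition gen_space ::
    "('k::field mpoly \<Rightarrow> 'm::ab_group_add \<Rightarrow> 'm) \<Rightarrow> 'm \<Rightarrow> nat set \<Rightarrow> 'm set" where
  "gen_space act w Z =
     module.span (\<lambda>c. act (const c)) {act (mono m) w |m. Poly_Mapping.keys m \<subseteq> Z}"

text \<open>\<open>V\<close> is a free module over \<open>R\<close>: it has a basis \<open>B\<close>. The finitely supported function
  \<open>f\<close> gives the coordinates with respect to \<open>B\<close>.\<close>

definition free_module_over ::
    "('k::field mpoly \<Rightarrow> 'm::ab_group_add \<Rightarrow> 'm) \<Rightarrow> 'k mpoly ring \<Rightarrow> 'm set \<Rightarrow> bool" where
  "free_module_over act R V \<longleftrightarrow>
     (\<exists>B\<subseteq>V. \<forall>v\<in>V. \<exists>!f. range f \<subseteq> carrier R \<and> finite {b. f b \<noteq> 0} \<and> {b. f b \<noteq> 0} \<subseteq> B \<and>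
        v = (\<Sum>b | f b \<noteq> 0. act (f b) b))"

definition is_stanley_space ::
    "('k::field mpoly \<Rightarrow> 'm::ab_group_add \<Rightarrow> 'm) \<Rightarrow> 'm \<Rightarrow> nat set \<Rightarrow> bool" where
  "is_stanley_space act w Z \<longleftrightarrow> free_module_over act (poly_ring Z) (gen_space act w Z)"

definition is_direct_sum :: "'m::ab_group_add set \<Rightarrow> 'm set list \<Rightarrow> bool" where
  "is_direct_sum M Vs \<longleftrightarrow>
     M = {\<Sum>i<length Vs. f i |f. \<forall>i<length Vs. f i \<in> Vs ! i} \<and>
     (\<forall>f g. (\<forall>i<length Vs. f i \<in> Vs ! i \<and> g i \<in> Vs ! i) \<longrightarrow>
        (\<Sum>i<length Vs. f i) = (\<Sum>i<length Vs. g i) \<longrightarrow> (\<forall>i<length Vs. f i = g i))"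

text \<open>The list \<open>[(u\<^sub>1,Z\<^sub>1), \<dots>, (u\<^sub>s,Z\<^sub>s)]\<close> stands for $\bigoplus_i u_iK[Z_i]$.\<close>

definition is_stanley_decomposition ::
    "nat \<Rightarrow> ('k::field mpoly \<Rightarrow> 'm::ab_group_add \<Rightarrow> 'm) \<Rightarrow> ('d \<Rightarrow> 'm set) \<Rightarrow> 'm set \<Rightarrow>
     ('m \<times> nat set) list \<Rightarrow> bool" where
  "is_stanley_decomposition n act G M D \<longleftrightarrow>
     (\<forall>(u, Z)\<in>set D. u \<in> M \<and> homogeneous G u \<and> Z \<subseteq> {1..n} \<and> is_stanley_space act u Z) \<and>
     is_direct_sum M (map (\<lambda>(u, Z). gen_space act u Z) D)"

definition sdepth_decomposition :: "('m \<times> nat set) list \<Rightarrow> nat" where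
  "sdepth_decomposition D = Min ((\<lambda>(u, Z). card Z) ` set D)"

text \<open>Meaningful for nonzero finitely generated \<open>M\<close>: then every Stanley decomposition has a
  summand, and its depth lies between \<open>0\<close> and \<open>n\<close>.\<close>

definition sdepth ::
    "nat \<Rightarrow> ('k::field mpoly \<Rightarrow> 'm::ab_group_add \<Rightarrow> 'm) \<Rightarrow> ('d \<Rightarrow> 'm set) \<Rightarrow> 'm set \<Rightarrow> nat" where
  "sdepth n act G M =
     Max {sdepth_decomposition D |D. is_stanley_decomposition n act G M D}"

text \<open>The standard multigrading: the component of degree \<open>a\<close> consists of the scalar multiples
  of $x^a$, and is zero if some \<open>a i\<close> is negative. A monomial ideal inherits this grading.\<close>

definition std_component :: "(nat \<Rightarrow> int) \<Rightarrow> 'k::field mpoly set" where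
  "std_component a = {p. \<forall>m\<in>Poly_Mapping.keys p. \<forall>i. int (Poly_Mapping.lookup m i) = a i}"

definition sdepth_ideal :: "nat \<Rightarrow> 'k::field mpoly set \<Rightarrow> nat" where
  "sdepth_ideal n I = sdepth n (*) (std_component :: (nat \<Rightarrow> int) \<Rightarrow> 'k mpoly set) I"

end

theory Submission
  imports Defs
begin

text \<open>Irreducibility gives $Q = (x_1^{a_1},\dots,x_t^{a_t})$ and
  $Q' = (x_{t+1}^{a_{t+1}},\dots,x_n^{a_n})$, so whether a monomial $x^m$ lies in $Q \cap Q'$ depends only
  on the set of those \<open>i\<close> with $m_i \ge a_i$: it has to meet both $\{1,\dots,t\}$ and
  $\{t+1,\dots,n\}$. A partition of the family of these sets into intervals $[A,B]$ with all
  \<open>B\<close> large yields a Stanley decomposition of large depth. Products reduce this to partitioning the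
  nonempty subsets of a \<open>k\<close>-set into intervals with $|B| \ge k/2$; for odd \<open>k\<close> one places the set on a
  circle and cuts the characteristic words into the tokens $1$, $10$, $00$, and for even \<open>k\<close> one adds
  a single interval.

  For the upper bound consider, in a decomposition of depth \<open>d\<close>, the monomials
  $x_i^{a_i} x_j^{a_j}$ with $i \le t < j$. Each generates, within the Stanley space containing it, at
  least $d - 2$ monomials $x_i^{a_i} x_j^{a_j} x_b^{a_b}$. Every such product of three powers contains two
  of the products of two powers, but lies in the Stanley space of at most one of them. Hence
  $2 (d - 2) \le n - 2$.\<close>

section \<open>Polynomials supported in a set of monomials\<close>

text \<open>The \<open>K\<close>-span of the monomials with exponent in \<open>U\<close>. All ideals
  and Stanley spaces below have this form, so inclusions, intersections and direct sums become
  statements about sets of exponent vectors.\<close>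

definition supported_in :: "(nat \<Rightarrow>\<^sub>0 nat) set \<Rightarrow> 'k::field mpoly set" where
  "supported_in U = {p. Poly_Mapping.keys p \<subseteq> U}"

text \<open>For \<open>A = {c}\<close> these are the exponents of the monomials in $x^c K[Z]$; for a
  set \<open>A\<close> of exponents of monomials of $K[Z]$ they are the exponents of the monomials
  in the ideal of $K[Z]$ generated by \<open>A\<close>.\<close>

definition multiples :: "nat set \<Rightarrow> (nat \<Rightarrow>\<^sub>0 nat) set \<Rightarrow> (nat \<Rightarrow>\<^sub>0 nat) set" where
  "multiples Z A = {a + m |a m. a \<in> A \<and> Poly_Mapping.keys m \<subseteq> Z}"

lemma subset_multiples: "A \<subseteq> multiples Z A"
proof
  fix a assume "a \<in> A"
  then have "a + 0 \<in> multiples Z A" unfolding multiples_def by (fastforce simp del: add_0_right)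
  then show "a \<in> multiples Z A" by simp
qed

lemma keys_add_nat: "Poly_Mapping.keys (a + b :: nat \<Rightarrow>\<^sub>0 nat) = Poly_Mapping.keys a \<union> Poly_Mapping.keys b"
  by (auto simp: in_keys_iff lookup_add)

lemma keys_multiples:
  assumes "z \<in> multiples Z A" "\<And>a. a \<in> A \<Longrightarrow> Poly_Mapping.keys a \<subseteq> Z"
  shows "Poly_Mapping.keys z \<subseteq> Z"
  using assms by (fastforce simp: multiples_def keys_add_nat)

lemma multiples_add:
  assumes "z \<in> multiples Z A" "Poly_Mapping.keys m \<subseteq> Z"
  shows "z + m \<in> multiples Z A"
proof -
  obtain a m' where "z = a + m'" "a \<in> A" "Poly_Mapping.keys m' \<subseteq> Z"
    using assms(1) by (auto simp: multiples_def)
  then have "z + m = a + (m' + m)" "Poly_Mapping.keys (m' + m) \<subseteq> Z"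
    using assms(2) by (simp_all add: add.assoc keys_add_nat)
  then show ?thesis using \<open>a \<in> A\<close> unfolding multiples_def by blast
qed

lemma supported_in_iff: "p \<in> supported_in U \<longleftrightarrow> (\<forall>m. Poly_Mapping.lookup p m \<noteq> 0 \<longrightarrow> m \<in> U)"
  by (auto simp: supported_in_def in_keys_iff)

lemma zero_in_supported_in [simp]: "0 \<in> supported_in U"
  by (simp add: supported_in_def)

lemma mono_in_supported_in [simp]: "mono m \<in> supported_in U \<longleftrightarrow> m \<in> U"
  by (simp add: supported_in_def mono_def)

lemma mono_nonzero [simp]: "mono m \<noteq> 0"
  by (metis lookup_single_eq lookup_zero mono_def zero_neq_one)

lemma mono_mult: "mono a * mono b = mono (a + b)"
  by (simp add: mono_def mult_single)

lemma lookup_const_mult: "Poly_Mapping.lookup (const c * p) m = c * Poly_Mapping.lookup p m"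
  by (simp add: const_def mult_map_scale_conv_mult[symmetric] Poly_Mapping.map.rep_eq when_def)

lemma supported_in_add: "p \<in> supported_in U \<Longrightarrow> q \<in> supported_in U \<Longrightarrow> p + q \<in> supported_in U"
  using keys_add[of p q] by (auto simp: supported_in_def)

lemma supported_in_uminus: "p \<in> supported_in U \<Longrightarrow> - p \<in> supported_in U"
  by (auto simp: supported_in_iff)

lemma supported_in_mult:
  assumes "p \<in> supported_in U" "q \<in> supported_in V" "\<And>u v. u \<in> U \<Longrightarrow> v \<in> V \<Longrightarrow> u + v \<in> W"
  shows "p * q \<in> supported_in W"
  using keys_mult[of p q] assms by (fastforce simp: supported_in_def)

lemma supported_in_inj: "supported_in U = (supported_in V :: 'k::field mpoly set) \<longleftrightarrow> U = V"
  by (metis mono_in_supported_in subsetI subset_antisym)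

lemma supported_in_mono: "supported_in U \<subseteq> (supported_in V :: 'k::field mpoly set) \<longleftrightarrow> U \<subseteq> V"
proof
  assume *: "supported_in U \<subseteq> (supported_in V :: 'k mpoly set)"
  show "U \<subseteq> V"
  proof
    fix m assume "m \<in> U"
    then have "(mono m :: 'k mpoly) \<in> supported_in V" using * by (intro subsetD[OF *]) simp
    then show "m \<in> V" by simp
  qed
qed (auto simp: supported_in_def)

lemma supported_in_Int: "supported_in U \<inter> supported_in V = supported_in (U \<inter> V)"
  by (auto simp: supported_in_def)

lemma sum_monomials:
  fixes p :: "'k::field mpoly"
  shows "p = (\<Sum>m\<in>Poly_Mapping.keys p. Poly_Mapping.single m (Poly_Mapping.lookup p m))"
proof (rule poly_mapping_eqI)
  fix k
  show "Poly_Mapping.lookup p k =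
    Poly_Mapping.lookup (\<Sum>m\<in>Poly_Mapping.keys p. Poly_Mapping.single m (Poly_Mapping.lookup p m)) k"
    by (simp add: lookup_sum lookup_single when_def in_keys_iff)
qed

lemma sum_closed:
  assumes "0 \<in> V" "\<And>x y. x \<in> V \<Longrightarrow> y \<in> V \<Longrightarrow> x + y \<in> V" "\<And>a. a \<in> A \<Longrightarrow> f a \<in> V"
  shows "sum f A \<in> V"
  using assms(3) by (induction A rule: infinite_finite_induct) (auto intro: assms(1,2))

lemma supported_in_sum:
  "(\<And>a. a \<in> A \<Longrightarrow> f a \<in> supported_in U) \<Longrightarrow> sum f A \<in> supported_in U"
  by (rule sum_closed) (simp_all add: supported_in_add)

lemma single_in_supported_in: "m \<in> U \<Longrightarrow> Poly_Mapping.single m c \<in> supported_in U"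
  by (simp add: supported_in_def)

section \<open>Monomial ideals\<close>

lemma poly_ring_simps:
  "carrier (poly_ring Z) = supported_in {m. Poly_Mapping.keys m \<subseteq> Z}"
  "mult (poly_ring Z) = (*)" "one (poly_ring Z) = 1" "zero (poly_ring Z) = 0"
  "add (poly_ring Z) = (+)"
  by (auto simp: poly_ring_def supported_in_def)

lemma poly_ring_mult_closed:
  "p \<in> carrier (poly_ring Z) \<Longrightarrow> q \<in> carrier (poly_ring Z) \<Longrightarrow> p * q \<in> carrier (poly_ring Z)"
  unfolding poly_ring_simps by (erule (1) supported_in_mult) (simp add: keys_add_nat)

lemma cring_poly_ring: "cring (poly_ring Z :: 'k::field mpoly ring)"
proof (rule cringI)
  show "abelian_group (poly_ring Z :: 'k mpoly ring)"
  proof (rule abelian_groupI)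
    fix x :: "'k mpoly" assume "x \<in> carrier (poly_ring Z)"
    then show "\<exists>y\<in>carrier (poly_ring Z). y \<oplus>\<^bsub>poly_ring Z\<^esub> x = \<zero>\<^bsub>poly_ring Z\<^esub>"
      unfolding poly_ring_simps by (intro bexI[of _ "- x"]) (simp_all add: supported_in_uminus)
  qed (auto simp: poly_ring_simps supported_in_add add_ac)
  have "(1 :: 'k mpoly) \<in> supported_in {m. Poly_Mapping.keys m \<subseteq> Z}"
    by (simp add: supported_in_def)
  then show "comm_monoid (poly_ring Z :: 'k mpoly ring)"
    using poly_ring_mult_closed[unfolded poly_ring_simps]
    by (intro comm_monoidI) (auto simp: poly_ring_simps mult_ac)
qed (auto simp: poly_ring_simps algebra_simps)

lemma poly_ring_pow: "f [^]\<^bsub>poly_ring Z\<^esub> (k::nat) = f ^ k"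
  by (induction k) (simp_all add: nat_pow_def poly_ring_simps mult.commute)

text \<open>The span absorbs multiplication by $K[Z]$, hence is an ideal. Conversely, an ideal
  containing the generators contains each term of a polynomial in the span, because such a term is a
  term of $K[Z]$ times a generator.\<close>

lemma genideal_monomials:
  assumes "\<And>a. a \<in> A \<Longrightarrow> Poly_Mapping.keys a \<subseteq> Z"
  shows "Idl\<^bsub>poly_ring Z\<^esub> (mono ` A) = (supported_in (multiples Z A) :: 'k::field mpoly set)"
proof
  have ring: "ring (poly_ring Z :: 'k mpoly ring)" using cring_poly_ring cring_def by blast
  have sub: "supported_in (multiples Z A) \<subseteq> (carrier (poly_ring Z) :: 'k mpoly set)"
    unfolding poly_ring_simps supported_in_mono
    using keys_multiples assms by blast
  have mult: "x * a \<in> supported_in (multiples Z A)"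
    if "a \<in> supported_in (multiples Z A)" "x \<in> carrier (poly_ring Z)" for a x :: "'k mpoly"
    using that unfolding poly_ring_simps mult.commute[of x]
    by (rule supported_in_mult) (simp add: multiples_add)
  have "ideal (supported_in (multiples Z A)) (poly_ring Z :: 'k mpoly ring)"
  proof (rule idealI[OF ring])
    interpret ring "poly_ring Z :: 'k mpoly ring" by (rule ring)
    show "subgroup (supported_in (multiples Z A)) (add_monoid (poly_ring Z :: 'k mpoly ring))"
    proof (rule add.subgroupI)
      show "supported_in (multiples Z A) \<noteq> ({} :: 'k mpoly set)" using zero_in_supported_in by fast
    next
      fix a :: "'k mpoly" assume a: "a \<in> supported_in (multiples Z A)"
      then have "\<ominus>\<^bsub>poly_ring Z\<^esub> a = - a"
        using sub supported_in_uminus[OF a]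
        by (intro minus_equality) (auto simp: poly_ring_simps(4,5))
      then show "\<ominus>\<^bsub>poly_ring Z\<^esub> a \<in> supported_in (multiples Z A)"
        using supported_in_uminus[OF a] by simp
    qed (use sub in \<open>auto simp: poly_ring_simps(5) supported_in_add\<close>)
  qed (use mult in \<open>simp_all add: poly_ring_simps(2) mult.commute\<close>)
  moreover have "mono ` A \<subseteq> (supported_in (multiples Z A) :: 'k mpoly set)"
    using subset_multiples by fastforce
  ultimately show "Idl\<^bsub>poly_ring Z\<^esub> (mono ` A) \<subseteq> (supported_in (multiples Z A) :: 'k mpoly set)"
    unfolding genideal_def by blast
  show "(supported_in (multiples Z A) :: 'k mpoly set) \<subseteq> Idl\<^bsub>poly_ring Z\<^esub> (mono ` A)"
    unfolding genideal_def
  proof (intro Inter_greatest subsetI)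
    fix I :: "'k mpoly set" and p :: "'k mpoly"
    assume "I \<in> {I. ideal I (poly_ring Z) \<and> mono ` A \<subseteq> I}" and p: "p \<in> supported_in (multiples Z A)"
    then have I: "ideal I (poly_ring Z)" "mono ` A \<subseteq> I" by auto
    interpret ideal I "poly_ring Z" by (rule I)
    have "(\<Sum>m\<in>Poly_Mapping.keys p. Poly_Mapping.single m (Poly_Mapping.lookup p m)) \<in> I"
    proof (rule sum_closed)
      show "0 \<in> I" using additive_subgroup.zero_closed[OF is_additive_subgroup]
        by (simp add: poly_ring_simps)
      show "x + y \<in> I" if "x \<in> I" "y \<in> I" for x y
        using additive_subgroup.a_closed[OF is_additive_subgroup that] by (simp add: poly_ring_simps)
    next
      fix m assume "m \<in> Poly_Mapping.keys p"
      then obtain a b where m: "m = a + b" "a \<in> A" "Poly_Mapping.keys b \<subseteq> Z"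
        using p by (auto simp: supported_in_def multiples_def)
      have "Poly_Mapping.single b (Poly_Mapping.lookup p m) \<in> carrier (poly_ring Z)"
        using m(3) by (auto simp: poly_ring_simps supported_in_def)
      moreover have "mono a \<in> I" using I m by auto
      ultimately have "Poly_Mapping.single b (Poly_Mapping.lookup p m) * mono a \<in> I"
        using I_l_closed by (simp add: poly_ring_simps)
      then show "Poly_Mapping.single m (Poly_Mapping.lookup p m) \<in> I"
        by (simp add: mono_def mult_single m add.commute)
    qed
    then show "p \<in> I" using sum_monomials[of p] by simp
  qed
qed

text \<open>An ideal generated by monomials is the span of their multiples, and a set
  \<open>U\<close> closed under multiples generates its own span.\<close>

lemma monomial_ideal_iff:
  "monomial_ideal n (I :: 'k::field mpoly set) \<longleftrightarrow>
     (\<exists>U. I = supported_in U \<and> (\<forall>u\<in>U. Poly_Mapping.keys u \<subseteq> {1..n}) \<and>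
        (\<forall>u\<in>U. \<forall>m. Poly_Mapping.keys m \<subseteq> {1..n} \<longrightarrow> u + m \<in> U))"
proof
  assume "monomial_ideal n I"
  then obtain A where A: "\<forall>m\<in>A. Poly_Mapping.keys m \<subseteq> {1..n}"
    "I = Idl\<^bsub>poly_ring {1..n}\<^esub> (mono ` A)" by (auto simp: monomial_ideal_def)
  then have "I = supported_in (multiples {1..n} A)" using genideal_monomials by blast
  then show "\<exists>U. I = supported_in U \<and> (\<forall>u\<in>U. Poly_Mapping.keys u \<subseteq> {1..n}) \<and>
      (\<forall>u\<in>U. \<forall>m. Poly_Mapping.keys m \<subseteq> {1..n} \<longrightarrow> u + m \<in> U)"
  proof (intro exI[of _ "multiples {1..n} A"] conjI ballI allI impI)
    show "Poly_Mapping.keys u \<subseteq> {1..n}" if "u \<in> multiples {1..n} A" for u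
      using keys_multiples[OF that] A(1) by blast
  qed (auto intro: multiples_add)
next
  assume "\<exists>U. I = supported_in U \<and> (\<forall>u\<in>U. Poly_Mapping.keys u \<subseteq> {1..n}) \<and>
        (\<forall>u\<in>U. \<forall>m. Poly_Mapping.keys m \<subseteq> {1..n} \<longrightarrow> u + m \<in> U)"
  then obtain U where U: "I = supported_in U" "\<forall>u\<in>U. Poly_Mapping.keys u \<subseteq> {1..n}"
    "\<forall>u\<in>U. \<forall>m. Poly_Mapping.keys m \<subseteq> {1..n} \<longrightarrow> u + m \<in> U" by blast
  note subset_multiples[of U "{1..n}"]
  moreover have "multiples {1..n} U \<subseteq> U" using U(3) by (auto simp: multiples_def)
  ultimately have "I = Idl\<^bsub>poly_ring {1..n}\<^esub> (mono ` U)"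
    using genideal_monomials[of U "{1..n}"] U by auto
  then show "monomial_ideal n I" unfolding monomial_ideal_def using U(2) by blast
qed

section \<open>Irreducible monomial ideals and pure powers\<close>

lemma irreducible_monomial_idealE:
  fixes Q :: "'k::field mpoly set"
  assumes "irreducible_monomial_ideal n Q"
  obtains U where "Q = supported_in U" and "\<And>m. m \<in> U \<Longrightarrow> Poly_Mapping.keys m \<subseteq> {1..n}"
    and "\<And>u m. u \<in> U \<Longrightarrow> Poly_Mapping.keys m \<subseteq> {1..n} \<Longrightarrow> u + m \<in> U"
proof -
  have "monomial_ideal n Q" using assms unfolding irreducible_monomial_ideal_def by (elim conjE)
  then obtain U where "Q = supported_in U" "\<forall>u\<in>U. Poly_Mapping.keys u \<subseteq> {1..n}"
    "\<forall>u\<in>U. \<forall>m. Poly_Mapping.keys m \<subseteq> {1..n} \<longrightarrow> u + m \<in> U"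
    unfolding monomial_ideal_iff by (elim exE conjE)
  then show ?thesis by (intro that[of U]) simp_all
qed

text \<open>If neither \<open>u\<close> nor \<open>v\<close> were in \<open>U\<close>, the ideal would be the intersection of the two larger
  ideals obtained by adding \<open>u\<close> and \<open>v\<close>, as a common multiple of coprime monomials is a multiple of
  their product.\<close>

lemma irreducible_monomial_ideal_coprime:
  fixes U :: "(nat \<Rightarrow>\<^sub>0 nat) set"
  assumes irr: "irreducible_monomial_ideal n (supported_in U :: 'k::field mpoly set)"
    and uv: "u + v \<in> U" "Poly_Mapping.keys u \<inter> Poly_Mapping.keys v = {}"
  shows "u \<in> U \<or> v \<in> U"
proof (rule ccontr)
  assume notin: "\<not> (u \<in> U \<or> v \<in> U)"
  let ?N = "{1..n}"
  obtain V where "supported_in U = (supported_in V :: 'k mpoly set)"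
    and "\<And>m. m \<in> V \<Longrightarrow> Poly_Mapping.keys m \<subseteq> ?N"
    and "\<And>u m. u \<in> V \<Longrightarrow> Poly_Mapping.keys m \<subseteq> ?N \<Longrightarrow> u + m \<in> V"
    using irreducible_monomial_idealE[OF irr] by metis
  then have U: "\<And>m. m \<in> U \<Longrightarrow> Poly_Mapping.keys m \<subseteq> ?N"
    and up: "\<And>u m. u \<in> U \<Longrightarrow> Poly_Mapping.keys m \<subseteq> ?N \<Longrightarrow> u + m \<in> U"
    by (simp_all add: supported_in_inj)
  have keys: "Poly_Mapping.keys u \<subseteq> ?N" "Poly_Mapping.keys v \<subseteq> ?N"
    using U[OF uv(1)] by (simp_all add: keys_add_nat)
  have ideal: "monomial_ideal n (supported_in (U \<union> multiples ?N {w}) :: 'k mpoly set)"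
    if "Poly_Mapping.keys w \<subseteq> ?N" for w
    unfolding monomial_ideal_iff
  proof (intro exI[of _ "U \<union> multiples ?N {w}"] conjI ballI allI impI refl)
    fix z assume z: "z \<in> U \<union> multiples ?N {w}"
    then show "Poly_Mapping.keys z \<subseteq> ?N"
      using U[of z] that keys_multiples[of z ?N "{w}"] by blast
    fix m :: "nat \<Rightarrow>\<^sub>0 nat" assume m: "Poly_Mapping.keys m \<subseteq> ?N"
    show "z + m \<in> U \<union> multiples ?N {w}"
      using z m up multiples_add by blast
  qed
  have bigger: "supported_in U \<subset> (supported_in (U \<union> multiples ?N {w}) :: 'k mpoly set)" if "w \<notin> U" for w
    unfolding psubset_eq supported_in_mono supported_in_inj using that subset_multiples[of "{w}" ?N] by auto
  have "multiples ?N {u} \<inter> multiples ?N {v} \<subseteq> U"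
  proof
    fix z assume "z \<in> multiples ?N {u} \<inter> multiples ?N {v}"
    then obtain m m' where z: "z = u + m" "z = v + m'" and m: "Poly_Mapping.keys m \<subseteq> ?N"
      unfolding multiples_def by blast
    \<comment> \<open>Where \<open>v\<close> involves the variable, \<open>u\<close> does not, so
      the whole exponent of \<open>z\<close> comes from \<open>m\<close> and is at least that of
      \<open>v\<close>; elsewhere the exponent of \<open>v\<close> is 0.\<close>
    have le: "Poly_Mapping.lookup v i \<le> Poly_Mapping.lookup m i" for i
    proof (cases "i \<in> Poly_Mapping.keys v")
      case True
      then have "Poly_Mapping.lookup u i = 0" using uv(2) by (auto simp: in_keys_iff)
      moreover have "Poly_Mapping.lookup z i = Poly_Mapping.lookup u i + Poly_Mapping.lookup m i"
        "Poly_Mapping.lookup z i = Poly_Mapping.lookup v i + Poly_Mapping.lookup m' i"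
        by (simp add: z(1) lookup_add) (simp add: z(2) lookup_add)
      ultimately show ?thesis by simp
    qed (simp add: in_keys_iff)
    have "z = (u + v) + (m - v)"
      by (rule poly_mapping_eqI) (use le in \<open>simp add: z(1) lookup_add lookup_minus\<close>)
    moreover have "Poly_Mapping.keys (m - v) \<subseteq> ?N" using m by (auto simp: in_keys_iff lookup_minus)
    ultimately show "z \<in> U" using up[OF uv(1)] by simp
  qed
  then have "U = (U \<union> multiples ?N {u}) \<inter> (U \<union> multiples ?N {v})" by blast
  then have "supported_in U = supported_in (U \<union> multiples ?N {u}) \<inter>
      (supported_in (U \<union> multiples ?N {v}) :: 'k mpoly set)"
    by (simp only: supported_in_Int)
  moreover have "u \<notin> U" "v \<notin> U" using notin by simp_all
  ultimately have "\<exists>J J' :: 'k mpoly set. monomial_ideal n J \<and> monomial_ideal n J' \<and>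
      supported_in U \<subset> J \<and> supported_in U \<subset> J' \<and> supported_in U = J \<inter> J'"
    using ideal keys bigger by (intro exI conjI)
  then show False using irr unfolding irreducible_monomial_ideal_def by (elim conjE notE)
qed

text \<open>Splitting off the power \<open>s\<close> of one variable leaves the coprime factor
  \<open>m - s\<close> with one variable less. One of the two lies in \<open>U\<close>, and
  induction on the number of variables finishes. \<open>0 \<notin> U\<close> rules out the monomial
  1, which has no variable to split off.\<close>

lemma irreducible_monomial_ideal_pure_power:
  fixes U :: "(nat \<Rightarrow>\<^sub>0 nat) set"
  assumes irr: "irreducible_monomial_ideal n (supported_in U :: 'k::field mpoly set)"
    and "0 \<notin> U" and "m \<in> U"
  shows "\<exists>i\<in>Poly_Mapping.keys m. Poly_Mapping.single i (Poly_Mapping.lookup m i) \<in> U"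
  using \<open>m \<in> U\<close>
proof (induction "card (Poly_Mapping.keys m)" arbitrary: m rule: less_induct)
  case less
  then have "m \<noteq> 0" using \<open>0 \<notin> U\<close> by auto
  then obtain i where i: "i \<in> Poly_Mapping.keys m" by (auto simp: keys_eq_empty[symmetric] simp del: keys_eq_empty)
  define s where "s = Poly_Mapping.single i (Poly_Mapping.lookup m i)"
  have lookup_s: "Poly_Mapping.lookup s j = (if j = i then Poly_Mapping.lookup m i else 0)" for j
    by (simp add: s_def lookup_single when_def)
  have m: "m = s + (m - s)"
    by (rule poly_mapping_eqI) (simp add: lookup_s lookup_add lookup_minus)
  have keys: "Poly_Mapping.keys (m - s) = Poly_Mapping.keys m - {i}"
    by (auto simp: in_keys_iff lookup_minus lookup_s split: if_splits)
  have "Poly_Mapping.keys s \<inter> Poly_Mapping.keys (m - s) = {}" unfolding keys by (auto simp: s_def split: if_splits)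
  then consider "s \<in> U" | "m - s \<in> U"
    using irreducible_monomial_ideal_coprime[OF irr, of s "m - s"] m \<open>m \<in> U\<close> by auto
  then show ?case
  proof cases
    case 2
    moreover have "card (Poly_Mapping.keys (m - s)) < card (Poly_Mapping.keys m)"
      unfolding keys using i by (intro psubset_card_mono) auto
    ultimately obtain j where "j \<in> Poly_Mapping.keys (m - s)"
      "Poly_Mapping.single j (Poly_Mapping.lookup (m - s) j) \<in> U" using less.hyps by blast
    moreover from this have "Poly_Mapping.lookup (m - s) j = Poly_Mapping.lookup m j"
      unfolding keys by (simp add: lookup_minus lookup_s)
    ultimately show ?thesis unfolding keys by auto
  qed (use i s_def in auto)
qed

lemma X_power: "(X i :: 'k::field mpoly) ^ k = mono (Poly_Mapping.single i k)"
proof (induction k)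
  case 0
  show ?case by (simp add: mono_def)
next
  case (Suc k)
  then show ?case by (simp add: X_def mono_mult flip: single_add)
qed

text \<open>The radical is used twice: it puts a power of each variable of \<open>T\<close> into
  \<open>Q\<close>, and it forces every monomial of \<open>Q\<close> to involve a variable of
  \<open>T\<close>, so that the pure powers in \<open>Q\<close> are powers of variables of
  \<open>T\<close>. The exponents \<open>a i\<close> are the least possible ones.\<close>

lemma irreducible_monomial_ideal_powers:
  fixes Q :: "'k::field mpoly set"
  assumes irr: "irreducible_monomial_ideal n Q"
    and rad: "radical (poly_ring {1..n}) Q = Idl\<^bsub>poly_ring {1..n}\<^esub> (X ` T)"
    and T: "T \<subseteq> {1..n}"
  shows "\<exists>a. (\<forall>i\<in>T. 1 \<le> a i) \<and>
    Q = supported_in {m. Poly_Mapping.keys m \<subseteq> {1..n} \<and> (\<exists>i\<in>T. a i \<le> Poly_Mapping.lookup m i)}"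
proof -
  let ?N = "{1..n}"
  obtain U where Q: "Q = supported_in U" and U: "\<And>m. m \<in> U \<Longrightarrow> Poly_Mapping.keys m \<subseteq> ?N"
    and up: "\<And>u m. u \<in> U \<Longrightarrow> Poly_Mapping.keys m \<subseteq> ?N \<Longrightarrow> u + m \<in> U"
    using irreducible_monomial_idealE[OF irr] by metis
  define V where "V = multiples ?N ((\<lambda>i. Poly_Mapping.single i (1::nat)) ` T)"
  have "Idl\<^bsub>poly_ring ?N\<^esub> (mono ` (\<lambda>i. Poly_Mapping.single i (1::nat)) ` T) = (supported_in V :: 'k mpoly set)"
    unfolding V_def by (rule genideal_monomials) (use T in auto)
  then have rad: "radical (poly_ring ?N) Q = supported_in V"
    unfolding rad by (simp add: X_def[abs_def] image_image)
  have pow: "\<exists>k. Poly_Mapping.single i k \<in> U" if "i \<in> T" for i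
  proof -
    have "Poly_Mapping.single i 1 \<in> V"
      unfolding V_def using that by (intro subsetD[OF subset_multiples] imageI)
    then have "(X i :: 'k mpoly) \<in> radical (poly_ring ?N) Q"
      unfolding rad X_def by simp
    then obtain k :: nat where "(X i :: 'k mpoly) ^ k \<in> Q"
      unfolding radical_def poly_ring_pow by auto
    then show ?thesis unfolding Q X_power by auto
  qed
  have "U \<subseteq> V"
  proof
    fix m assume "m \<in> U"
    \<comment> \<open>Exponent 1 in the definition of the radical: \<open>Q\<close> is contained in
      it.\<close>
    then have "(mono m :: 'k mpoly) [^]\<^bsub>poly_ring ?N\<^esub> (1::nat) \<in> Q"
      "(mono m :: 'k mpoly) \<in> carrier (poly_ring ?N)"
      using U by (simp_all add: poly_ring_pow poly_ring_simps Q)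
    then have "(mono m :: 'k mpoly) \<in> radical (poly_ring ?N) Q" unfolding radical_def by blast
    then show "m \<in> V" unfolding rad by simp
  qed
  have V: "\<exists>i\<in>T. i \<in> Poly_Mapping.keys m" if "m \<in> V" for m
    using that by (auto simp: V_def multiples_def keys_add_nat)
  \<comment> \<open>The monomial 1 involves no variable. This excludes the unit ideal and later
    gives \<open>1 \<le> a i\<close>.\<close>
  have zero: "0 \<notin> U" using \<open>U \<subseteq> V\<close> V[of 0] by auto
  define a where "a i = (LEAST k. Poly_Mapping.single i k \<in> U)" for i
  have a: "Poly_Mapping.single i (a i) \<in> U" if "i \<in> T" for i
    unfolding a_def using pow[OF that] by (rule LeastI_ex)
  have "U = {m. Poly_Mapping.keys m \<subseteq> ?N \<and> (\<exists>i\<in>T. a i \<le> Poly_Mapping.lookup m i)}"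
  proof (intro equalityI subsetI)
    fix m assume m: "m \<in> U"
    obtain i where i: "i \<in> Poly_Mapping.keys m" "Poly_Mapping.single i (Poly_Mapping.lookup m i) \<in> U"
      using irreducible_monomial_ideal_pure_power[OF irr[unfolded Q] zero m] by blast
    then have "i \<in> T" using V \<open>U \<subseteq> V\<close> by (fastforce split: if_splits)
    moreover have "a i \<le> Poly_Mapping.lookup m i" unfolding a_def using i(2) by (rule Least_le)
    ultimately show "m \<in> {m. Poly_Mapping.keys m \<subseteq> ?N \<and> (\<exists>i\<in>T. a i \<le> Poly_Mapping.lookup m i)}"
      using U[OF m] by blast
  next
    fix m assume "m \<in> {m. Poly_Mapping.keys m \<subseteq> ?N \<and> (\<exists>i\<in>T. a i \<le> Poly_Mapping.lookup m i)}"
    then obtain i where i: "i \<in> T" "a i \<le> Poly_Mapping.lookup m i" "Poly_Mapping.keys m \<subseteq> ?N" by blast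
    have "m = Poly_Mapping.single i (a i) + (m - Poly_Mapping.single i (a i))"
      by (rule poly_mapping_eqI) (use i(2) in \<open>auto simp: lookup_add lookup_minus lookup_single when_def\<close>)
    moreover have "Poly_Mapping.keys (m - Poly_Mapping.single i (a i)) \<subseteq> ?N"
      using i(3) by (auto simp: in_keys_iff lookup_minus)
    ultimately show "m \<in> U" using up[OF a[OF i(1)]] by metis
  qed
  moreover have "1 \<le> a i" if "i \<in> T" for i
    using a[OF that] zero by (cases "a i") auto
  ultimately show ?thesis using Q by (intro exI[of _ a]) simp
qed

section \<open>Interval partitions\<close>

text \<open>\<open>d\<close> bounds the upper ends because the set \<open>B\<close> of an interval
  \<open>[A, B]\<close> becomes the variable set of Stanley spaces.\<close>

definition interval_partition :: "nat \<Rightarrow> 'a set set \<Rightarrow> ('a set \<times> 'a set) set \<Rightarrow> bool" where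
  "interval_partition d \<C> F \<longleftrightarrow> finite F \<and>
     (\<forall>A B. (A, B) \<in> F \<longrightarrow> A \<subseteq> B \<and> d \<le> card B) \<and>
     (\<forall>A B C. (A, B) \<in> F \<longrightarrow> A \<subseteq> C \<longrightarrow> C \<subseteq> B \<longrightarrow> C \<in> \<C>) \<and>
     (\<forall>C\<in>\<C>. \<exists>A B. (A, B) \<in> F \<and> A \<subseteq> C \<and> C \<subseteq> B) \<and>
     (\<forall>A B A' B' C. (A, B) \<in> F \<longrightarrow> (A', B') \<in> F \<longrightarrow>
        A \<subseteq> C \<longrightarrow> C \<subseteq> B \<longrightarrow> A' \<subseteq> C \<longrightarrow> C \<subseteq> B' \<longrightarrow> (A, B) = (A', B'))"

lemma interval_partitionI:
  assumes "finite F"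
    and "\<And>A B. (A, B) \<in> F \<Longrightarrow> A \<subseteq> B"
    and "\<And>A B. (A, B) \<in> F \<Longrightarrow> d \<le> card B"
    and "\<And>A B C. (A, B) \<in> F \<Longrightarrow> A \<subseteq> C \<Longrightarrow> C \<subseteq> B \<Longrightarrow> C \<in> \<C>"
    and "\<And>C. C \<in> \<C> \<Longrightarrow> \<exists>A B. (A, B) \<in> F \<and> A \<subseteq> C \<and> C \<subseteq> B"
    and "\<And>A B A' B' C. (A, B) \<in> F \<Longrightarrow> (A', B') \<in> F \<Longrightarrow>
           A \<subseteq> C \<Longrightarrow> C \<subseteq> B \<Longrightarrow> A' \<subseteq> C \<Longrightarrow> C \<subseteq> B' \<Longrightarrow> (A, B) = (A', B')"
  shows "interval_partition d \<C> F"
  unfolding interval_partition_def by (intro conjI allI ballI impI; (rule assms; assumption)?)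

lemma interval_partition_finite: "interval_partition d \<C> F \<Longrightarrow> finite F"
  unfolding interval_partition_def by (elim conjE)

lemma interval_partition_cover:
  assumes "interval_partition d \<C> F" "C \<in> \<C>"
  obtains A B where "(A, B) \<in> F" "A \<subseteq> C" "C \<subseteq> B"
proof -
  have "\<forall>C\<in>\<C>. \<exists>A B. (A, B) \<in> F \<and> A \<subseteq> C \<and> C \<subseteq> B"
    using assms(1) unfolding interval_partition_def by (elim conjE)
  with assms(2) that show ?thesis by blast
qed

lemma interval_partition_disjoint:
  assumes "interval_partition d \<C> F" "(A, B) \<in> F" "(A', B') \<in> F"
    and "A \<subseteq> C" "C \<subseteq> B" "A' \<subseteq> C" "C \<subseteq> B'"
  shows "A = A'" "B = B'"
proof -
  have "\<forall>A B A' B' C. (A, B) \<in> F \<longrightarrow> (A', B') \<in> F \<longrightarrow>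
      A \<subseteq> C \<longrightarrow> C \<subseteq> B \<longrightarrow> A' \<subseteq> C \<longrightarrow> C \<subseteq> B' \<longrightarrow> (A, B) = (A', B')"
    using assms(1) unfolding interval_partition_def by (elim conjE)
  from this[rule_format, OF assms(2-7)] show "A = A'" "B = B'" by simp_all
qed

lemma interval_partition_memD:
  assumes "interval_partition d \<C> F" "(A, B) \<in> F"
  shows "A \<subseteq> B" "d \<le> card B" "A \<subseteq> C \<Longrightarrow> C \<subseteq> B \<Longrightarrow> C \<in> \<C>" "A \<in> \<C>" "B \<in> \<C>"
proof -
  have "\<forall>A B. (A, B) \<in> F \<longrightarrow> A \<subseteq> B \<and> d \<le> card B"
    and *: "\<forall>A B C. (A, B) \<in> F \<longrightarrow> A \<subseteq> C \<longrightarrow> C \<subseteq> B \<longrightarrow> C \<in> \<C>"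
    using assms(1) unfolding interval_partition_def by simp_all
  then show AB: "A \<subseteq> B" "d \<le> card B" using assms(2) by simp_all
  show C: "A \<subseteq> C \<Longrightarrow> C \<subseteq> B \<Longrightarrow> C \<in> \<C>" for C using *[rule_format, OF assms(2)] .
  show "A \<in> \<C>" "B \<in> \<C>" using C AB(1) by simp_all
qed

text \<open>Write the characteristic word of \<open>C\<close> around a circle of length \<open>k\<close> and cut it into the tokens
  $1$, $10$, $00$, which is possible in exactly one way unless \<open>C\<close> is empty. The set \<open>S\<close> of
  the following lemmas consists of the second positions of the two-letter tokens; the first letters of
  these tokens are free, which gives the interval containing \<open>C\<close>.\<close>

lemma card_cyclically_independent:
  assumes "S \<subseteq> {..<k}" and ind: "\<And>x. x \<in> S \<Longrightarrow> Suc x mod k \<notin> S"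
  shows "2 * card S \<le> k"
proof (cases "k = 0")
  case False
  have fin: "finite S" using assms(1) finite_subset by blast
  have inj: "inj_on (\<lambda>x. Suc x mod k) S"
  proof (rule inj_onI)
    fix x y assume "x \<in> S" "y \<in> S" "Suc x mod k = Suc y mod k"
    then have "x mod k = y mod k" "x < k" "y < k"
      using assms(1) by (auto simp: mod_Suc split: if_splits)
    then show "x = y" by simp
  qed
  \<comment> \<open>\<open>S\<close> and its cyclic shift are disjoint and equally large.\<close>
  have "card (S \<union> (\<lambda>x. Suc x mod k) ` S) = card S + card S"
    using fin ind by (subst card_Un_disjoint) (auto simp: card_image[OF inj])
  moreover have "card (S \<union> (\<lambda>x. Suc x mod k) ` S) \<le> card {..<k}"
    using assms(1) False by (intro card_mono) auto
  ultimately show ?thesis by simp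
qed (use assms in auto)

lemma cyclic_steps_to_member:
  fixes k :: nat
  assumes "y \<in> C" "C \<subseteq> {..<k}" "x < k"
  shows "\<exists>e. (x + e) mod k \<in> C"
proof
  \<comment> \<open>\<open>k - x\<close> steps lead from \<open>x\<close> to position 0, and
    \<open>y\<close> further steps to \<open>y\<close>.\<close>
  show "(x + (k - x + y)) mod k \<in> C"
    using assms by auto
qed

text \<open>A member of \<open>C\<close> belongs to neither set, and elsewhere the recurrence passes
  from the next position to the present one; hence induction on the number \<open>e\<close> of steps
  to a member of \<open>C\<close>.\<close>

lemma cyclic_recurrence_unique:
  assumes C: "C \<subseteq> {..<k}" "C \<noteq> {}"
    and S: "\<And>x. x < k \<Longrightarrow> x \<in> S \<longleftrightarrow> x \<notin> C \<and> Suc x mod k \<notin> S"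
    and S': "\<And>x. x < k \<Longrightarrow> x \<in> S' \<longleftrightarrow> x \<notin> C \<and> Suc x mod k \<notin> S'"
    and "x < k"
  shows "x \<in> S \<longleftrightarrow> x \<in> S'"
proof -
  from C obtain y where "y \<in> C" by auto
  have "\<forall>x<k. (x + e) mod k \<in> C \<longrightarrow> (x \<in> S \<longleftrightarrow> x \<in> S')" for e
  proof (induction e)
    case 0
    show ?case
    proof (intro allI impI)
      fix x assume "x < k" "(x + 0) mod k \<in> C"
      then have "x \<in> C" by simp
      then show "x \<in> S \<longleftrightarrow> x \<in> S'" using S[OF \<open>x < k\<close>] S'[OF \<open>x < k\<close>] by blast
    qed
  next
    case (Suc e)
    show ?case
    proof (intro allI impI)
      fix x assume "x < k" "(x + Suc e) mod k \<in> C"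
      then have "Suc x mod k < k" "(Suc x mod k + e) mod k \<in> C"
        by (auto simp: mod_simps)
      then show "x \<in> S \<longleftrightarrow> x \<in> S'"
        using Suc.IH S[OF \<open>x < k\<close>] S'[OF \<open>x < k\<close>] by auto
    qed
  qed
  then show ?thesis using cyclic_steps_to_member[OF \<open>y \<in> C\<close> C(1) \<open>x < k\<close>] \<open>x < k\<close> by blast
qed

text \<open>Parity solves the recurrence: \<open>S\<close> consists of the positions whose forward
  distance \<open>e\<close> to the next member of \<open>C\<close> is odd, and off \<open>C\<close>
  one step forward lowers this distance by one.\<close>

lemma cyclic_recurrence_exists:
  assumes C: "C \<subseteq> {..<k}" "C \<noteq> {}"
  obtains S where "S \<subseteq> {..<k}"
    and "\<And>x. x < k \<Longrightarrow> x \<in> S \<longleftrightarrow> x \<notin> C \<and> Suc x mod k \<notin> S"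
proof
  define e where "e x = (LEAST e. (x + e) mod k \<in> C)" for x
  define S where "S = {x \<in> {..<k}. odd (e x)}"
  show "S \<subseteq> {..<k}" by (auto simp: S_def)
  fix x assume x: "x < k"
  from C obtain y where y: "y \<in> C" by auto
  show "x \<in> S \<longleftrightarrow> x \<notin> C \<and> Suc x mod k \<notin> S"
  proof (cases "x \<in> C")
    case True
    then have "e x = 0" using x by (auto simp: e_def intro!: Least_eq_0)
    then show ?thesis using True by (auto simp: S_def)
  next
    case False
    obtain a where "(x + a) mod k \<in> C"
      using cyclic_steps_to_member[OF y C(1) x] by blast
    then have "e x = Suc (LEAST m. (x + Suc m) mod k \<in> C)"
      unfolding e_def by (rule Least_Suc) (use False x in simp)
    also have "\<dots> = Suc (e (Suc x mod k))"
      unfolding e_def by (simp add: mod_simps)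
    finally show ?thesis using False x by (auto simp: S_def)
  qed
qed

text \<open>For \<open>C\<close> to lie in the interval from \<open>lo S\<close> to
  \<open>{..<k} - S\<close> amounts to the recurrence linking \<open>S\<close> and \<open>C\<close>.
  Its unique solvability for nonempty \<open>C\<close> makes these intervals a partition.\<close>

lemma interval_partition_odd:
  assumes "odd k"
  shows "\<exists>F. interval_partition ((k + 1) div 2) {C. C \<subseteq> {..<k} \<and> C \<noteq> {}} F"
proof -
  define ind where "ind S \<longleftrightarrow> S \<subseteq> {..<k} \<and> (\<forall>x\<in>S. Suc x mod k \<notin> S)" for S
  \<comment> \<open>\<open>lo S\<close> holds the positions of the one-letter tokens, which are
    always 1. First positions of two-letter tokens lie in neither \<open>S\<close> nor
    \<open>lo S\<close> and stay free.\<close>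
  define lo where "lo S = {x \<in> {..<k}. x \<notin> S \<and> Suc x mod k \<notin> S}" for S
  define F where "F = (\<lambda>S. (lo S, {..<k} - S)) ` {S. ind S}"
  have k: "k > 0" using assms by (auto intro: Nat.gr0I)
  have rec: "x \<in> S \<longleftrightarrow> x \<notin> C \<and> Suc x mod k \<notin> S"
    if "ind S" "lo S \<subseteq> C" "C \<subseteq> {..<k} - S" "x < k" for S C x
    using that by (auto simp: ind_def lo_def)
  have large: "(k + 1) div 2 \<le> card ({..<k} - S)" if "ind S" for S
  proof -
    have "2 * card S \<le> k"
      using that by (intro card_cyclically_independent) (auto simp: ind_def)
    moreover have "card ({..<k} - S) = k - card S"
      using that finite_subset[of S "{..<k}"] by (subst card_Diff_subset) (auto simp: ind_def)
    ultimately show ?thesis using assms by presburger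
  qed
  \<comment> \<open>The recurrence for the empty set makes \<open>S\<close> alternate, which is impossible on an odd cycle.\<close>
  have nonempty: "C \<noteq> {}" if "ind S" "lo S \<subseteq> C" for S C
  proof
    assume "C = {}"
    then have lo: "lo S = {}" using that by auto
    have alt: "x \<in> S \<longleftrightarrow> Suc x mod k \<notin> S" if "x < k" for x
      using lo that \<open>ind S\<close> by (auto simp: lo_def ind_def)
    have "j < k \<Longrightarrow> (j \<in> S \<longleftrightarrow> (even j \<longleftrightarrow> 0 \<in> S))" for j
    proof (induction j)
      case (Suc j)
      then show ?case using alt[of j] by auto
    qed simp
    from this[of "k - 1"] have "k - 1 \<in> S \<longleftrightarrow> 0 \<in> S" using assms k by auto
    moreover have "k - 1 \<in> S \<longleftrightarrow> 0 \<notin> S" using alt[of "k - 1"] k by auto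
    ultimately show False by blast
  qed
  have "interval_partition ((k + 1) div 2) {C. C \<subseteq> {..<k} \<and> C \<noteq> {}} F"
  proof (rule interval_partitionI)
    have "{S. ind S} \<subseteq> Pow {..<k}" by (auto simp: ind_def)
    then show "finite F" unfolding F_def using finite_subset by blast
  next
    fix A B assume "(A, B) \<in> F"
    then obtain S where S: "ind S" and AB: "A = lo S" "B = {..<k} - S" by (auto simp: F_def)
    show "A \<subseteq> B" by (auto simp: AB lo_def)
    show "(k + 1) div 2 \<le> card B" unfolding AB by (rule large[OF S])
    fix C assume "A \<subseteq> C" "C \<subseteq> B"
    then show "C \<in> {C. C \<subseteq> {..<k} \<and> C \<noteq> {}}"
      using nonempty[OF S, of C] by (simp add: AB) blast
  next
    fix C assume "C \<in> {C. C \<subseteq> {..<k} \<and> C \<noteq> {}}"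
    then have C: "C \<subseteq> {..<k}" "C \<noteq> {}" by auto
    from cyclic_recurrence_exists[OF C] obtain S where S: "S \<subseteq> {..<k}"
      "\<And>x. x < k \<Longrightarrow> x \<in> S \<longleftrightarrow> x \<notin> C \<and> Suc x mod k \<notin> S" by blast
    have "ind S" and "lo S \<subseteq> C" and "C \<subseteq> {..<k} - S"
      using S C by (auto simp: ind_def lo_def)
    then show "\<exists>A B. (A, B) \<in> F \<and> A \<subseteq> C \<and> C \<subseteq> B" unfolding F_def by blast
  next
    fix A B A' B' C assume *: "(A, B) \<in> F" "(A', B') \<in> F" "A \<subseteq> C" "C \<subseteq> B" "A' \<subseteq> C" "C \<subseteq> B'"
    then obtain S S' where S: "ind S" "A = lo S" "B = {..<k} - S"
      and S': "ind S'" "A' = lo S'" "B' = {..<k} - S'" by (auto simp: F_def)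
    have C: "C \<subseteq> {..<k}" "C \<noteq> {}" using * S nonempty[OF S(1), of C] by auto
    have "x \<in> S \<longleftrightarrow> x \<in> S'" if "x < k" for x
      using cyclic_recurrence_unique[OF C rec[OF S(1)] rec[OF S'(1)] that] * S S' by auto
    then have "S = S'" using S(1) S'(1) by (auto simp: ind_def)
    then show "(A, B) = (A', B')" using S S' by simp
  qed
  then show ?thesis ..
qed

section \<open>Constructions with interval partitions\<close>

text \<open>The sets containing the new point \<open>x\<close> form the single interval from
  \<open>{x}\<close> to \<open>insert x T\<close>, whose upper end is large enough by the assumption
  on \<open>d\<close>.\<close>

lemma interval_partition_insert:
  assumes F: "interval_partition d {C. C \<subseteq> T \<and> C \<noteq> {}} F"
    and "finite T" "x \<notin> T" "d \<le> Suc (card T)"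
  shows "interval_partition d {C. C \<subseteq> insert x T \<and> C \<noteq> {}} (insert ({x}, insert x T) F)"
proof (rule interval_partitionI)
  have sub: "x \<notin> B" "A \<subseteq> B" "B \<subseteq> T" "A \<noteq> {}" if "(A, B) \<in> F" for A B
    using interval_partition_memD[OF F that] \<open>x \<notin> T\<close> by auto
  show "finite (insert ({x}, insert x T) F)" using interval_partition_finite[OF F] by simp
  {
    fix A B assume AB: "(A, B) \<in> insert ({x}, insert x T) F"
    then show "A \<subseteq> B" "d \<le> card B" using interval_partition_memD(1,2)[OF F] assms by auto
    fix C assume "A \<subseteq> C" "C \<subseteq> B"
    then show "C \<in> {C. C \<subseteq> insert x T \<and> C \<noteq> {}}" using AB sub(3,4)[of A B] by auto
  next
    fix C assume C: "C \<in> {C. C \<subseteq> insert x T \<and> C \<noteq> {}}"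
    show "\<exists>A B. (A, B) \<in> insert ({x}, insert x T) F \<and> A \<subseteq> C \<and> C \<subseteq> B"
    proof (cases "x \<in> C")
      case False
      then have "C \<in> {C. C \<subseteq> T \<and> C \<noteq> {}}" using C by auto
      then show ?thesis by (rule interval_partition_cover[OF F]) blast
    qed (use C in auto)
  next
    fix A B A' B' C
    assume "(A, B) \<in> insert ({x}, insert x T) F" "(A', B') \<in> insert ({x}, insert x T) F"
      and C: "A \<subseteq> C" "C \<subseteq> B" "A' \<subseteq> C" "C \<subseteq> B'"
    then consider "(A, B) = (A', B')" | "x \<in> A" "(A', B') \<in> F" | "x \<in> A'" "(A, B) \<in> F"
      | "(A, B) \<in> F" "(A', B') \<in> F" by auto
    then show "(A, B) = (A', B')"
    proof cases
      case 4
      then show ?thesis using interval_partition_disjoint[OF F 4 C] by simp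
    qed (use sub(1) C in blast)+
  }
qed

lemma interval_partition_image:
  assumes F: "interval_partition d {C. C \<subseteq> T \<and> C \<noteq> {}} F"
    and f: "inj_on f T"
  shows "interval_partition d {C. C \<subseteq> f ` T \<and> C \<noteq> {}} (map_prod ((`) f) ((`) f) ` F)"
    (is "interval_partition d _ ?F")
proof (rule interval_partitionI)
  have sub: "A \<subseteq> B" "A \<subseteq> T" "B \<subseteq> T" "A \<noteq> {}" "d \<le> card B" if "(A, B) \<in> F" for A B
    using interval_partition_memD[OF F that] by auto
  show "finite ?F" using interval_partition_finite[OF F] by simp
  {
    fix A B assume "(A, B) \<in> ?F"
    then obtain A0 B0 where AB: "A = f ` A0" "B = f ` B0" and in0: "(A0, B0) \<in> F" by auto
    have "card B = card B0"
      using f sub(3)[OF in0] AB(2) by (auto intro: card_image inj_on_subset)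
    then show "A \<subseteq> B" "d \<le> card B" using sub[OF in0] AB by auto
    fix C assume "A \<subseteq> C" "C \<subseteq> B"
    moreover have "f ` B0 \<subseteq> f ` T" "f ` A0 \<noteq> {}" using sub(3,4)[OF in0] by auto
    ultimately show "C \<in> {C. C \<subseteq> f ` T \<and> C \<noteq> {}}" using AB by blast
  next
    fix D assume "D \<in> {C. C \<subseteq> f ` T \<and> C \<noteq> {}}"
    then obtain C where D: "D = f ` C" and C: "C \<in> {C. C \<subseteq> T \<and> C \<noteq> {}}"
      by (auto simp: subset_image_iff)
    from C obtain A B where "(A, B) \<in> F" "A \<subseteq> C" "C \<subseteq> B" by (rule interval_partition_cover[OF F])
    then have "(f ` A, f ` B) \<in> ?F" "f ` A \<subseteq> D" "D \<subseteq> f ` B" using D by auto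
    then show "\<exists>A B. (A, B) \<in> ?F \<and> A \<subseteq> D \<and> D \<subseteq> B" by (intro exI conjI)
  next
    fix A B A' B' D
    assume *: "(A, B) \<in> ?F" "(A', B') \<in> ?F" "A \<subseteq> D" "D \<subseteq> B" "A' \<subseteq> D" "D \<subseteq> B'"
    then obtain A0 B0 A1 B1 where AB: "A = f ` A0" "B = f ` B0" "A' = f ` A1" "B' = f ` B1"
      and in0: "(A0, B0) \<in> F" and in1: "(A1, B1) \<in> F" by auto
    obtain C where D: "D = f ` C" "C \<subseteq> T"
      using *(4) AB(2) sub(3)[OF in0] by (meson subset_imageE order_trans)
    have iff: "f ` P \<subseteq> f ` R \<longleftrightarrow> P \<subseteq> R" if "P \<subseteq> T" "R \<subseteq> T" for P R
      using f that by (auto simp: inj_on_def subset_iff image_iff) metis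
    have "A0 \<subseteq> C" "C \<subseteq> B0" "A1 \<subseteq> C" "C \<subseteq> B1"
      using * AB D sub(2,3)[OF in0] sub(2,3)[OF in1] by (simp_all add: iff)
    from interval_partition_disjoint[OF F in0 in1 this]
    show "(A, B) = (A', B')" using AB by simp
  }
qed

text \<open>An even \<open>k > 0\<close> is treated via the odd number \<open>k - 1\<close>: the
  halves of both round up to the same number, so the added interval does not lower the bound. A
  bijection moves the result to \<open>T\<close>.\<close>

lemma interval_partition_nonempty_subsets:
  assumes "finite T"
  shows "\<exists>F. interval_partition ((card T + 1) div 2) {C. C \<subseteq> T \<and> C \<noteq> {}} F"
proof -
  have "\<exists>F. interval_partition ((k + 1) div 2) {C. C \<subseteq> {..<k} \<and> C \<noteq> {}} F" for k :: nat
  proof (cases "odd k")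
    case False
    show ?thesis
    proof (cases k)
      case 0
      have "interval_partition 0 {C. C \<subseteq> {} \<and> C \<noteq> {}} {}"
        by (auto simp: interval_partition_def)
      then show ?thesis using 0 by auto
    next
      case (Suc j)
      then have "odd j" using False by auto
      then obtain F where "interval_partition ((j + 1) div 2) {C. C \<subseteq> {..<j} \<and> C \<noteq> {}} F"
        using interval_partition_odd by blast
      from interval_partition_insert[OF this, of j] have
        "interval_partition ((j + 1) div 2) {C. C \<subseteq> {..<k} \<and> C \<noteq> {}} (insert ({j}, {..<k}) F)"
        using Suc by (simp add: lessThan_Suc)
      moreover have "(k + 1) div 2 = (j + 1) div 2" using Suc \<open>odd j\<close> by presburger
      ultimately show ?thesis by auto
    qed
  qed (rule interval_partition_odd)
  then obtain F where F: "interval_partition ((card T + 1) div 2) {C. C \<subseteq> {..<card T} \<and> C \<noteq> {}} F"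
    by blast
  obtain f where "bij_betw f {..<card T} T"
    using ex_bij_betw_nat_finite[OF assms] by (auto simp: atLeast0LessThan)
  then show ?thesis using interval_partition_image[OF F, of f] by (auto simp: bij_betw_def)
qed

text \<open>A subset of the disjoint union is determined by its traces on \<open>T\<close> and
  \<open>T'\<close>, and it lies in a product interval exactly if both traces lie in the factors.
  The sizes of the upper ends add up.\<close>

lemma interval_partition_product:
  assumes F: "interval_partition d {C. C \<subseteq> T \<and> C \<noteq> {}} F"
    and F': "interval_partition d' {C. C \<subseteq> T' \<and> C \<noteq> {}} F'"
    and T: "finite T" "finite T'" "T \<inter> T' = {}"
  shows "interval_partition (d + d') {C. C \<subseteq> T \<union> T' \<and> C \<inter> T \<noteq> {} \<and> C \<inter> T' \<noteq> {}}
           ((\<lambda>((A, B), (A', B')). (A \<union> A', B \<union> B')) ` (F \<times> F'))"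
    (is "interval_partition _ ?C ?F")
proof (rule interval_partitionI)
  have sub: "A \<subseteq> B" "A \<subseteq> T" "B \<subseteq> T" "A \<noteq> {}" "d \<le> card B" if "(A, B) \<in> F" for A B
    using interval_partition_memD[OF F that] by auto
  have sub': "A \<subseteq> B" "A \<subseteq> T'" "B \<subseteq> T'" "A \<noteq> {}" "d' \<le> card B" if "(A, B) \<in> F'" for A B
    using interval_partition_memD[OF F' that] by auto
  have split: "A \<union> A' \<subseteq> C \<longleftrightarrow> A \<subseteq> C \<inter> T \<and> A' \<subseteq> C \<inter> T'"
    "C \<subseteq> B \<union> B' \<longleftrightarrow> C \<subseteq> T \<union> T' \<and> C \<inter> T \<subseteq> B \<and> C \<inter> T' \<subseteq> B'"
    if "(A, B) \<in> F" "(A', B') \<in> F'" for A B A' B' C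
    using sub(2,3)[OF that(1)] sub'(2,3)[OF that(2)] T(3) by blast+
  show "finite ?F" using interval_partition_finite[OF F] interval_partition_finite[OF F'] by simp
  {
    fix A B assume "(A, B) \<in> ?F"
    then obtain A1 B1 A2 B2 where AB: "A = A1 \<union> A2" "B = B1 \<union> B2"
      and in1: "(A1, B1) \<in> F" and in2: "(A2, B2) \<in> F'" by auto
    show "A \<subseteq> B" using sub(1)[OF in1] sub'(1)[OF in2] AB by auto
    have "card B = card B1 + card B2"
      unfolding AB using sub(3)[OF in1] sub'(3)[OF in2] T
      by (intro card_Un_disjoint) (auto dest: finite_subset)
    then show "d + d' \<le> card B" using sub(5)[OF in1] sub'(5)[OF in2] by simp
    fix C assume "A \<subseteq> C" "C \<subseteq> B"
    then show "C \<in> ?C" using AB sub(2-4)[OF in1] sub'(2-4)[OF in2] by auto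
  next
    fix C assume C: "C \<in> ?C"
    then have "C \<inter> T \<in> {C. C \<subseteq> T \<and> C \<noteq> {}}" "C \<inter> T' \<in> {C. C \<subseteq> T' \<and> C \<noteq> {}}" by auto
    then obtain A B A' B' where AB: "(A, B) \<in> F" "(A', B') \<in> F'"
      and "A \<subseteq> C \<inter> T" "C \<inter> T \<subseteq> B" "A' \<subseteq> C \<inter> T'" "C \<inter> T' \<subseteq> B'"
      by (metis interval_partition_cover[OF F] interval_partition_cover[OF F'])
    then have sandwich: "A \<union> A' \<subseteq> C" "C \<subseteq> B \<union> B'" using split[OF AB] C by auto
    have "(A \<union> A', B \<union> B') \<in> ?F" using AB by force
    then show "\<exists>A B. (A, B) \<in> ?F \<and> A \<subseteq> C \<and> C \<subseteq> B" using sandwich by (intro exI conjI)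
  next
    fix A B A' B' C
    assume *: "(A, B) \<in> ?F" "(A', B') \<in> ?F" and C: "A \<subseteq> C" "C \<subseteq> B" "A' \<subseteq> C" "C \<subseteq> B'"
    from *(1) obtain A1 B1 A2 B2 where AB: "A = A1 \<union> A2" "B = B1 \<union> B2"
      and in1: "(A1, B1) \<in> F" and in2: "(A2, B2) \<in> F'" by auto
    from *(2) obtain A3 B3 A4 B4 where AB': "A' = A3 \<union> A4" "B' = B3 \<union> B4"
      and in3: "(A3, B3) \<in> F" and in4: "(A4, B4) \<in> F'" by auto
    have s: "A1 \<subseteq> C \<inter> T" "C \<inter> T \<subseteq> B1" "A2 \<subseteq> C \<inter> T'" "C \<inter> T' \<subseteq> B2"
      using C AB split[OF in1 in2] by simp_all
    have s': "A3 \<subseteq> C \<inter> T" "C \<inter> T \<subseteq> B3" "A4 \<subseteq> C \<inter> T'" "C \<inter> T' \<subseteq> B4"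
      using C AB' split[OF in3 in4] by simp_all
    show "(A, B) = (A', B')"
      using interval_partition_disjoint[OF F in1 in3 s(1,2) s'(1,2)]
        interval_partition_disjoint[OF F' in2 in4 s(3,4) s'(3,4)] AB AB' by simp
  }
qed

section \<open>Stanley decompositions of monomial spaces\<close>

lemma multiples_single_iff:
  "m \<in> multiples Z {c} \<longleftrightarrow> (\<forall>i. Poly_Mapping.lookup c i \<le> Poly_Mapping.lookup m i \<and>
     (i \<notin> Z \<longrightarrow> Poly_Mapping.lookup m i = Poly_Mapping.lookup c i))"
proof
  assume "m \<in> multiples Z {c}"
  then obtain r where "m = c + r" "Poly_Mapping.keys r \<subseteq> Z" by (auto simp: multiples_def)
  then show "\<forall>i. Poly_Mapping.lookup c i \<le> Poly_Mapping.lookup m i \<and>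
     (i \<notin> Z \<longrightarrow> Poly_Mapping.lookup m i = Poly_Mapping.lookup c i)"
    by (auto simp: lookup_add in_keys_iff)
next
  assume *: "\<forall>i. Poly_Mapping.lookup c i \<le> Poly_Mapping.lookup m i \<and>
     (i \<notin> Z \<longrightarrow> Poly_Mapping.lookup m i = Poly_Mapping.lookup c i)"
  then have "m = c + (m - c)" by (intro poly_mapping_eqI) (simp add: lookup_add lookup_minus)
  moreover have "Poly_Mapping.keys (m - c) \<subseteq> Z" using * by (auto simp: in_keys_iff lookup_minus)
  ultimately show "m \<in> multiples Z {c}" by (auto simp: multiples_def)
qed

section \<open>Stanley spaces of homogeneous polynomials\<close>

lemma module_mpoly: "module (\<lambda>c. (*) (const c :: 'k::field mpoly))"
proof unfold_locales
  fix a b :: 'k and x y :: "'k mpoly"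
  show "const a * (x + y) = const a * x + const a * y" by (rule distrib_left)
  show "const (a + b) * x = const a * x + const b * x"
    by (simp add: const_def single_add distrib_right)
  show "const a * (const b * x) = const (a * b) * x"
    by (simp add: const_def mult_single flip: mult.assoc)
  show "const 1 * x = x" by (simp add: const_def)
qed

text \<open>A multidegree fixes the exponent vector, so a graded component has dimension at most
  one. The case of 0 remains because 0 belongs to every component.\<close>

lemma homogeneous_cases:
  fixes u :: "'k::field mpoly"
  assumes "homogeneous std_component u"
  obtains "u = 0" | c k where "k \<noteq> 0" "u = Poly_Mapping.single c k"
proof (cases "u = 0")
  case False
  obtain a where a: "\<And>m i. m \<in> Poly_Mapping.keys u \<Longrightarrow> int (Poly_Mapping.lookup m i) = a i"
    using assms by (auto simp: homogeneous_def std_component_def)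
  obtain c where c: "c \<in> Poly_Mapping.keys u" using False by (metis all_not_in_conv keys_eq_empty)
  have "m = c" if "m \<in> Poly_Mapping.keys u" for m
    by (rule poly_mapping_eqI) (metis a that c of_nat_eq_iff)
  then have "u = Poly_Mapping.single c (Poly_Mapping.lookup u c)"
    by (intro poly_mapping_eqI) (auto simp: lookup_single when_def in_keys_iff)
  moreover have "Poly_Mapping.lookup u c \<noteq> 0" using c by (simp add: in_keys_iff)
  ultimately show ?thesis using that(2) by blast
qed (rule that(1))

text \<open>Formulated with \<open>keys u\<close> so as to cover \<open>u = 0\<close>, where both
  sides are the zero space. Otherwise \<open>u\<close> is a monomial up to a nonzero scalar, which
  can be divided out.\<close>

lemma gen_space_homogeneous:
  fixes u :: "'k::field mpoly"
  assumes "homogeneous std_component u"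
  shows "gen_space (*) u Z = supported_in (multiples Z (Poly_Mapping.keys u))"
  using assms
proof (cases rule: homogeneous_cases)
  case 1
  have "{mono m * 0 |m. Poly_Mapping.keys m \<subseteq> Z} = {0 :: 'k mpoly}"
    by (auto intro: exI[of _ 0])
  then have "gen_space (*) u Z = module.span (\<lambda>c. (*) (const c :: 'k mpoly)) {0}"
    unfolding gen_space_def 1 by simp
  also have "\<dots> = {0}"
  proof
    interpret module "\<lambda>c. (*) (const c :: 'k mpoly)" by (rule module_mpoly)
    show "span {0} \<subseteq> {0}" by (rule span_minimal) (auto simp: subspace_def)
    show "{0} \<subseteq> span {0}" using span_zero by blast
  qed
  also have "\<dots> = supported_in (multiples Z (Poly_Mapping.keys u))"
    using 1 by (auto simp: supported_in_def multiples_def)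
  finally show ?thesis .
next
  case (2 c k)
  interpret module "\<lambda>c. (*) (const c :: 'k mpoly)" by (rule module_mpoly)
  define B where "B = {mono m * u |m. Poly_Mapping.keys m \<subseteq> Z}"
  have keys: "Poly_Mapping.keys u = {c}" using 2 by simp
  have "span B \<subseteq> supported_in (multiples Z {c})"
  proof (rule span_minimal)
    have "mono m * u \<in> supported_in (multiples Z {c})" if "Poly_Mapping.keys m \<subseteq> Z" for m
      using that unfolding 2(2) mono_def mult_single
      by (auto simp: supported_in_def multiples_def add.commute)
    then show "B \<subseteq> supported_in (multiples Z {c})" by (auto simp: B_def)
    show "subspace (supported_in (multiples Z {c}))"
      by (rule subspaceI) (auto simp: supported_in_add, auto simp: supported_in_iff lookup_const_mult)
  qed
  moreover have "p \<in> span B" if p: "p \<in> supported_in (multiples Z {c})" for p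
  proof -
    have "Poly_Mapping.single m (Poly_Mapping.lookup p m) \<in> span B" if "m \<in> Poly_Mapping.keys p" for m
    proof -
      obtain r where r: "m = c + r" "Poly_Mapping.keys r \<subseteq> Z"
        using p \<open>m \<in> Poly_Mapping.keys p\<close> by (auto simp: supported_in_def multiples_def)
      have "const (Poly_Mapping.lookup p m / k) * (mono r * u) \<in> span B"
        using r(2) by (intro span_scale span_base) (auto simp: B_def)
      also have "const (Poly_Mapping.lookup p m / k) * (mono r * u) = Poly_Mapping.single m (Poly_Mapping.lookup p m)"
        using 2(1) unfolding 2(2) r(1) by (simp add: const_def mono_def mult_single add.commute)
      finally show ?thesis .
    qed
    then show ?thesis by (subst sum_monomials) (rule span_sum)
  qed
  ultimately show ?thesis unfolding gen_space_def B_def keys by auto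
qed

lemma homogeneous_mono: "homogeneous std_component (mono c :: 'k::field mpoly)"
  unfolding homogeneous_def std_component_def mono_def
  by (intro exI[of _ "\<lambda>i. int (Poly_Mapping.lookup c i)"]) simp

lemma gen_space_mono: "gen_space (*) (mono c) Z = (supported_in (multiples Z {c}) :: 'k::field mpoly set)"
  using gen_space_homogeneous[OF homogeneous_mono, of c Z] by (simp add: mono_def)

text \<open>The element \<open>mono c\<close> alone is a basis over $K[Z]$: the coordinate of
  \<open>v\<close> is its quotient by this monomial, unique because the polynomial ring has no zero
  divisors.\<close>

lemma is_stanley_space_mono: "is_stanley_space (*) (mono c :: 'k::field mpoly) Z"
  unfolding is_stanley_space_def free_module_over_def gen_space_mono
proof (intro exI[of _ "{mono c}"] conjI ballI)
  show "{mono c :: 'k mpoly} \<subseteq> supported_in (multiples Z {c})"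
    using subset_multiples[of "{c}" Z] by simp
next
  fix v :: "'k mpoly" assume v: "v \<in> supported_in (multiples Z {c})"
  let ?P = "\<lambda>f :: 'k mpoly \<Rightarrow> 'k mpoly. range f \<subseteq> carrier (poly_ring Z) \<and> finite {b. f b \<noteq> 0} \<and>
    {b. f b \<noteq> 0} \<subseteq> {mono c} \<and> v = (\<Sum>b | f b \<noteq> 0. f b * b)"
  have sum: "(\<Sum>b | f b \<noteq> 0. f b * b) = f (mono c) * mono c" if "{b. f b \<noteq> 0} \<subseteq> {mono c}"
    for f :: "'k mpoly \<Rightarrow> 'k mpoly"
  proof -
    have "(\<Sum>b | f b \<noteq> 0. f b * b) = (\<Sum>b\<in>{mono c}. f b * b)"
      using that by (intro sum.mono_neutral_left) auto
    then show ?thesis by simp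
  qed
  \<comment> \<open>The quotient of \<open>v\<close> by \<open>mono c\<close>, formed term by term;
    no difference \<open>m - c\<close> is truncated, as every exponent of \<open>v\<close> is
    \<open>c\<close> plus an exponent supported in \<open>Z\<close>.\<close>
  define q where "q = (\<Sum>m\<in>Poly_Mapping.keys v. Poly_Mapping.single (m - c) (Poly_Mapping.lookup v m))"
  have "m - c + c = m \<and> Poly_Mapping.keys (m - c) \<subseteq> Z" if "m \<in> Poly_Mapping.keys v" for m
  proof -
    have "m \<in> multiples Z {c}" using that v by (auto simp: supported_in_def)
    then obtain r where "m = c + r" "Poly_Mapping.keys r \<subseteq> Z" by (auto simp: multiples_def)
    then show ?thesis by (simp add: add.commute)
  qed
  then have m: "m - c + c = m" "Poly_Mapping.keys (m - c) \<subseteq> Z" if "m \<in> Poly_Mapping.keys v" for m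
    using that by simp_all
  have "q * mono c = (\<Sum>m\<in>Poly_Mapping.keys v. Poly_Mapping.single m (Poly_Mapping.lookup v m))"
    unfolding q_def sum_distrib_right using m(1) by (intro sum.cong) (simp_all add: mono_def mult_single)
  then have qc: "q * mono c = v" using sum_monomials[of v] by simp
  have "q \<in> carrier (poly_ring Z)"
    unfolding q_def poly_ring_simps
    by (intro supported_in_sum single_in_supported_in) (simp add: m(2))
  moreover have supp: "{b. (if b = mono c then q else 0) \<noteq> 0} \<subseteq> {mono c :: 'k mpoly}" by auto
  ultimately have "?P (\<lambda>b. if b = mono c then q else 0)"
    unfolding sum[OF supp] using finite_subset[OF supp] qc
    by (auto simp: poly_ring_simps(1) simp del: finite_Collect_conjI)
  moreover have "f = (\<lambda>b. if b = mono c then q else 0)" if "?P f" for f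
  proof
    fix b
    have "f (mono c) * mono c = q * mono c" using that sum[of f] qc by simp
    then have "f (mono c) = q" by simp
    then show "f b = (if b = mono c then q else 0)" using that by auto
  qed
  ultimately show "\<exists>!f. ?P f" by (rule ex1I)
qed

section \<open>Direct sums and partitions of the exponents\<close>

text \<open>Since the exponent sets partition \<open>U\<close>, the coefficient of a sum at a
  monomial of \<open>U\<close> is that of the single summand allowed to contain it. This gives both
  existence and uniqueness of the components.\<close>

lemma is_direct_sum_supported_in:
  assumes cover: "\<And>m. m \<in> U \<longleftrightarrow> (\<exists>i<length Ws. m \<in> Ws ! i)"
    and disj: "\<And>i j m. i < length Ws \<Longrightarrow> j < length Ws \<Longrightarrow> m \<in> Ws ! i \<Longrightarrow> m \<in> Ws ! j \<Longrightarrow> i = j"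
  shows "is_direct_sum (supported_in U :: 'k::field mpoly set) (map supported_in Ws)"
proof -
  let ?n = "length Ws"
  have lookup: "Poly_Mapping.lookup (\<Sum>i<?n. f i) m = Poly_Mapping.lookup (f j) m"
    if f: "\<forall>i<?n. f i \<in> supported_in (Ws ! i)" and j: "j < ?n" "m \<in> Ws ! j"
    for f :: "nat \<Rightarrow> 'k mpoly" and m j
  proof -
    have "Poly_Mapping.lookup (f i) m = (if i = j then Poly_Mapping.lookup (f j) m else 0)" if "i < ?n" for i
    proof (cases "i = j")
      case False
      then have "m \<notin> Ws ! i" using disj that j by blast
      then show ?thesis using f that False by (auto simp: supported_in_iff)
    qed simp
    then have "(\<Sum>i<?n. Poly_Mapping.lookup (f i) m) = (\<Sum>i<?n. if i = j then Poly_Mapping.lookup (f j) m else 0)"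
      by (intro sum.cong) auto
    then show ?thesis using j by (simp add: lookup_sum)
  qed
  have "p \<in> {\<Sum>i<?n. f i |f. \<forall>i<?n. f i \<in> supported_in (Ws ! i)}" if p: "p \<in> supported_in U" for p :: "'k mpoly"
  proof -
    \<comment> \<open>The part of \<open>p\<close> formed by its terms with exponent in
      \<open>Ws ! i\<close>.\<close>
    define f where "f i = Poly_Mapping.mapp (\<lambda>m x. if m \<in> Ws ! i then x else 0) p" for i
    have f: "Poly_Mapping.lookup (f i) m = (if m \<in> Ws ! i then Poly_Mapping.lookup p m else 0)" for i m
      by (simp add: f_def lookup_mapp in_keys_iff when_def)
    then have supp: "\<forall>i<?n. f i \<in> supported_in (Ws ! i)" by (simp add: supported_in_iff)
    have "p = (\<Sum>i<?n. f i)"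
    proof (rule poly_mapping_eqI)
      fix m
      show "Poly_Mapping.lookup p m = Poly_Mapping.lookup (\<Sum>i<?n. f i) m"
      proof (cases "m \<in> U")
        case True
        then obtain j where "j < ?n" "m \<in> Ws ! j" using cover by blast
        then show ?thesis using lookup[OF supp] f by simp
      next
        case False
        then have "\<forall>i<?n. m \<notin> Ws ! i" using cover by blast
        then show ?thesis using False p by (auto simp: lookup_sum f supported_in_iff)
      qed
    qed
    then show ?thesis using supp by blast
  qed
  moreover have "(\<Sum>i<?n. f i) \<in> supported_in U" if "\<forall>i<?n. f i \<in> supported_in (Ws ! i)" for f :: "nat \<Rightarrow> 'k mpoly"
  proof (rule supported_in_sum)
    fix i assume "i \<in> {..<?n}"
    then have "supported_in (Ws ! i) \<subseteq> (supported_in U :: 'k mpoly set)"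
      unfolding supported_in_mono using cover by blast
    then show "f i \<in> supported_in U" using that \<open>i \<in> {..<?n}\<close> by blast
  qed
  moreover have "f i = g i" if f: "\<forall>i<?n. f i \<in> supported_in (Ws ! i)"
    and g: "\<forall>i<?n. g i \<in> supported_in (Ws ! i)" and eq: "(\<Sum>i<?n. f i) = (\<Sum>i<?n. g i)" and i: "i < ?n"
    for f g :: "nat \<Rightarrow> 'k mpoly" and i
  proof (rule poly_mapping_eqI)
    fix m
    show "Poly_Mapping.lookup (f i) m = Poly_Mapping.lookup (g i) m"
    proof (cases "m \<in> Ws ! i")
      case True
      then show ?thesis using lookup[OF f i] lookup[OF g i] eq by metis
    next
      case False
      then have "Poly_Mapping.lookup (f i) m = 0" "Poly_Mapping.lookup (g i) m = 0"
        using f g i unfolding supported_in_iff by blast+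
      then show ?thesis by simp
    qed
  qed
  ultimately have "supported_in U = {\<Sum>i<?n. f i |f :: nat \<Rightarrow> 'k mpoly. \<forall>i<?n. f i \<in> supported_in (Ws ! i)}"
    "\<forall>f g :: nat \<Rightarrow> 'k mpoly. (\<forall>i<?n. f i \<in> supported_in (Ws ! i) \<and> g i \<in> supported_in (Ws ! i)) \<longrightarrow>
       (\<Sum>i<?n. f i) = (\<Sum>i<?n. g i) \<longrightarrow> (\<forall>i<?n. f i = g i)"
    by blast+
  then show ?thesis unfolding is_direct_sum_def by (simp cong: conj_cong)
qed

text \<open>Writing a monomial as a sum of components shows that some summand contains it, and a
  monomial in two summands would have two different representations.\<close>

lemma is_direct_sum_supported_inD:
  assumes "is_direct_sum (supported_in U :: 'k::field mpoly set) (map supported_in Ws)"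
  shows "m \<in> U \<Longrightarrow> \<exists>i<length Ws. m \<in> Ws ! i"
    and "i < length Ws \<Longrightarrow> j < length Ws \<Longrightarrow> m \<in> Ws ! i \<Longrightarrow> m \<in> Ws ! j \<Longrightarrow> i = j"
proof -
  let ?n = "length Ws"
  have sum: "supported_in U = {\<Sum>i<?n. f i |f :: nat \<Rightarrow> 'k mpoly. \<forall>i<?n. f i \<in> supported_in (Ws ! i)}"
    using assms by (auto simp: is_direct_sum_def cong: conj_cong)
  have uniq: "f i = g i" if "\<forall>i<?n. f i \<in> supported_in (Ws ! i)" "\<forall>i<?n. g i \<in> supported_in (Ws ! i)"
    "(\<Sum>i<?n. f i) = (\<Sum>i<?n. g i)" "i < ?n" for f g :: "nat \<Rightarrow> 'k mpoly" and i
    using assms that by (auto simp: is_direct_sum_def)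
  show "\<exists>i<?n. m \<in> Ws ! i" if "m \<in> U"
  proof (rule ccontr)
    assume none: "\<not> (\<exists>i<?n. m \<in> Ws ! i)"
    have "(mono m :: 'k mpoly) \<in> supported_in U" using that by simp
    then obtain f :: "nat \<Rightarrow> 'k mpoly" where f: "mono m = (\<Sum>i<?n. f i)"
      "\<forall>i<?n. f i \<in> supported_in (Ws ! i)" unfolding sum by blast
    have "Poly_Mapping.lookup (f i) m = 0" if "i < ?n" for i
      using f(2) none that unfolding supported_in_iff by blast
    then have "Poly_Mapping.lookup (mono m :: 'k mpoly) m = 0" unfolding f(1) by (simp add: lookup_sum)
    then show False by (simp add: mono_def)
  qed
  show "i = j" if ij: "i < ?n" "j < ?n" "m \<in> Ws ! i" "m \<in> Ws ! j"
  proof (rule ccontr)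
    assume "i \<noteq> j"
    define f where "f l k = (if k = l then mono m else 0 :: 'k mpoly)" for l k :: nat
    have f: "\<forall>k<?n. f l k \<in> supported_in (Ws ! k)" if "m \<in> Ws ! l" for l using that by (simp add: f_def)
    have sum_f: "(\<Sum>k<?n. f l k) = mono m" if "l < ?n" for l using that by (simp add: f_def)
    have "f i i = f j i"
      by (rule uniq[OF f[OF ij(3)] f[OF ij(4)] _ ij(1)]) (simp only: sum_f[OF ij(1)] sum_f[OF ij(2)])
    then show False using \<open>i \<noteq> j\<close> by (simp add: f_def)
  qed
qed

section \<open>From interval partitions to Stanley decompositions\<close>

text \<open>The indices \<open>i\<close> for which $x_i^{a_i}$ divides $x^m$; for monomials of $S$,
  membership in the ideals considered depends on this set alone.\<close>

definition large_exponents :: "nat \<Rightarrow> (nat \<Rightarrow> nat) \<Rightarrow> (nat \<Rightarrow>\<^sub>0 nat) \<Rightarrow> nat set" where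
  "large_exponents n a m = {i \<in> {1..n}. a i \<le> Poly_Mapping.lookup m i}"

text \<open>Stanley decompositions are finite lists, so the generators constructed below, whose
  exponents are at most \<open>a i\<close>, must be finite in number.\<close>

lemma finite_bounded_exponents:
  assumes "finite N"
  shows "finite {c :: nat \<Rightarrow>\<^sub>0 nat. Poly_Mapping.keys c \<subseteq> N \<and> (\<forall>i\<in>N. Poly_Mapping.lookup c i \<le> a i)}"
    (is "finite ?S")
proof (rule finite_imageD)
  have "Poly_Mapping.lookup ` ?S \<subseteq>
      {f. \<forall>i. (i \<in> N \<longrightarrow> f i \<in> {..Max (a ` N)}) \<and> (i \<notin> N \<longrightarrow> f i = 0)}"
  proof
    fix f assume "f \<in> Poly_Mapping.lookup ` ?S"
    then obtain c where f: "f = Poly_Mapping.lookup c" and c: "Poly_Mapping.keys c \<subseteq> N"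
      "\<And>i. i \<in> N \<Longrightarrow> Poly_Mapping.lookup c i \<le> a i" by auto
    have "f i \<le> Max (a ` N)" if "i \<in> N" for i
      unfolding f by (rule order_trans[OF c(2)[OF that] Max_ge]) (use assms that in auto)
    then show "f \<in> {f. \<forall>i. (i \<in> N \<longrightarrow> f i \<in> {..Max (a ` N)}) \<and> (i \<notin> N \<longrightarrow> f i = 0)}"
      using c(1) by (auto simp: f in_keys_iff subset_iff)
  qed
  then show "finite (Poly_Mapping.lookup ` ?S)"
    by (rule finite_subset) (intro finite_set_of_finite_funs assms finite_atMost)
  show "inj_on Poly_Mapping.lookup ?S" by (auto simp: inj_on_def intro: poly_mapping_eqI)
qed

text \<open>Monomials whose set of large exponents lies in \<open>[A, B]\<close> have exponents at
  least \<open>a i\<close> on \<open>A\<close>, arbitrary ones on \<open>B - A\<close> and small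
  ones off \<open>B\<close>. Once the last are fixed, these are the monomials of one space with
  variable set \<open>B\<close>, of dimension at least \<open>d\<close>.\<close>

lemma ex_stanley_decomposition:
  assumes F: "interval_partition d \<C> F" and sub: "\<C> \<subseteq> Pow {1..n}"
    and a: "\<forall>i\<in>{1..n}. 1 \<le> a i"
  shows "\<exists>D. is_stanley_decomposition n (*) (std_component :: (nat \<Rightarrow> int) \<Rightarrow> 'k::field mpoly set)
      (supported_in {m. Poly_Mapping.keys m \<subseteq> {1..n} \<and> large_exponents n a m \<in> \<C>}) D \<and>
    (\<forall>(u, Z)\<in>set D. d \<le> card Z)"
proof -
  let ?N = "{1..n}"
  let ?U = "{m. Poly_Mapping.keys m \<subseteq> ?N \<and> large_exponents n a m \<in> \<C>}"
  \<comment> \<open>An interval \<open>[A, B]\<close> becomes one space $x^c K[B]$ for each choice of exponents below \<open>a\<close> off \<open>B\<close>.\<close>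
  define gen where "gen A B c \<longleftrightarrow> (A, B) \<in> F \<and> Poly_Mapping.keys c \<subseteq> ?N \<and>
    (\<forall>i\<in>?N. if i \<in> A then Poly_Mapping.lookup c i = a i else
       if i \<in> B then Poly_Mapping.lookup c i = 0 else Poly_Mapping.lookup c i < a i)" for A B c
  have gen_lookup: "if i \<in> A then Poly_Mapping.lookup c i = a i else
       if i \<in> B then Poly_Mapping.lookup c i = 0 else Poly_Mapping.lookup c i < a i"
    if "gen A B c" "i \<in> ?N" for A B c i
    using that unfolding gen_def by blast
  define J where "J = {(c, B). \<exists>A. gen A B c}"
  have F_sub: "A \<subseteq> B" "B \<subseteq> ?N" "d \<le> card B" if "(A, B) \<in> F" for A B
    using interval_partition_memD[OF F that] sub by auto
  have "J \<subseteq> {c. Poly_Mapping.keys c \<subseteq> ?N \<and> (\<forall>i\<in>?N. Poly_Mapping.lookup c i \<le> a i)} \<times> Pow ?N"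
  proof
    fix x assume "x \<in> J"
    then obtain c B A where x: "x = (c, B)" and g: "gen A B c" by (auto simp: J_def)
    have "Poly_Mapping.lookup c i \<le> a i" if "i \<in> ?N" for i
      using gen_lookup[OF g that] by (simp split: if_splits)
    moreover have "B \<subseteq> ?N" "Poly_Mapping.keys c \<subseteq> ?N" using g F_sub(2) unfolding gen_def by blast+
    ultimately show "x \<in> {c. Poly_Mapping.keys c \<subseteq> ?N \<and> (\<forall>i\<in>?N. Poly_Mapping.lookup c i \<le> a i)} \<times> Pow ?N"
      unfolding x by blast
  qed
  then have "finite J"
    by (rule finite_subset) (intro finite_cartesian_product finite_bounded_exponents; simp)
  then obtain xs where xs: "set xs = J" "distinct xs" using finite_distinct_list by blast
  have interval: "Poly_Mapping.keys m \<subseteq> ?N \<and> A \<subseteq> large_exponents n a m \<and> large_exponents n a m \<subseteq> B"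
    if g: "gen A B c" and m: "m \<in> multiples B {c}" for A B c m
  proof (intro conjI subsetI)
    have AB: "(A, B) \<in> F" and c: "Poly_Mapping.keys c \<subseteq> ?N" using g unfolding gen_def by blast+
    note m = m[unfolded multiples_single_iff, rule_format]
    show "i \<in> ?N" if "i \<in> Poly_Mapping.keys m" for i
    proof (cases "i \<in> B")
      case False
      then have "i \<in> Poly_Mapping.keys c" using m[of i] that by (simp add: in_keys_iff)
      then show ?thesis using c by blast
    qed (use F_sub(2)[OF AB] in blast)
    show "i \<in> large_exponents n a m" if "i \<in> A" for i
    proof -
      have "i \<in> ?N" using F_sub[OF AB] that by blast
      then have "Poly_Mapping.lookup c i = a i" using gen_lookup[OF g, of i] that by simp
      then show ?thesis using m[of i] \<open>i \<in> ?N\<close> by (simp add: large_exponents_def)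
    qed
    show "i \<in> B" if i: "i \<in> large_exponents n a m" for i
    proof (rule ccontr)
      assume "i \<notin> B"
      moreover have "i \<in> ?N" using i by (simp add: large_exponents_def)
      ultimately have "Poly_Mapping.lookup c i < a i"
        using gen_lookup[OF g, of i] F_sub(1)[OF AB] by (auto split: if_splits)
      then show False using m[of i] i \<open>i \<notin> B\<close> by (simp add: large_exponents_def)
    qed
  qed
  have cover: "m \<in> ?U \<longleftrightarrow> (\<exists>(c, B)\<in>J. m \<in> multiples B {c})" for m
  proof
    assume m: "m \<in> ?U"
    then have "large_exponents n a m \<in> \<C>" by blast
    from interval_partition_cover[OF F this] obtain A B where AB: "(A, B) \<in> F"
      "A \<subseteq> large_exponents n a m" "large_exponents n a m \<subseteq> B" by metis
    \<comment> \<open>The generator of the space that is to contain \<open>m\<close>: exponents are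
      lowered to \<open>a i\<close> on \<open>A\<close> and to 0 on \<open>B - A\<close>, and kept
      off \<open>B\<close>. \<open>mapp\<close> does not change zero exponents, but on
      \<open>A\<close> those of \<open>m\<close> are positive.\<close>
    define c where "c = Poly_Mapping.mapp (\<lambda>i x. if i \<in> A then a i else if i \<in> B then 0 else x) m"
    have lookup_c: "Poly_Mapping.lookup c i =
        (if i \<in> A then a i else if i \<in> B then 0 else Poly_Mapping.lookup m i)" for i
    proof (cases "i \<in> A")
      case True
      then have "a i \<le> Poly_Mapping.lookup m i" "1 \<le> a i"
        using AB(2) a by (auto simp: large_exponents_def)
      then show ?thesis using True by (simp add: c_def lookup_mapp in_keys_iff)
    qed (simp add: c_def lookup_mapp in_keys_iff when_def)
    have "Poly_Mapping.keys c \<subseteq> Poly_Mapping.keys m" unfolding c_def by (rule keys_mapp_subset)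
    then have "Poly_Mapping.keys c \<subseteq> ?N" by (rule order_trans) (use m in simp)
    moreover have "Poly_Mapping.lookup m i < a i" if "i \<in> ?N" "i \<notin> B" for i
      using that AB(3) by (force simp: large_exponents_def)
    ultimately have "gen A B c" using AB(1) unfolding gen_def by (simp add: lookup_c)
    moreover have "m \<in> multiples B {c}"
      unfolding multiples_single_iff lookup_c using AB(2) F_sub(1)[OF AB(1)]
      by (auto simp: large_exponents_def)
    ultimately show "\<exists>(c, B)\<in>J. m \<in> multiples B {c}" unfolding J_def by blast
  next
    assume "\<exists>(c, B)\<in>J. m \<in> multiples B {c}"
    then obtain c B A where g: "gen A B c" and m: "m \<in> multiples B {c}" unfolding J_def by blast
    then have "(A, B) \<in> F" unfolding gen_def by blast
    then show "m \<in> ?U" using interval[OF g m] interval_partition_memD(3)[OF F] by blast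
  qed
  have disj: "c = c' \<and> B = B'" if J: "(c, B) \<in> J" "(c', B') \<in> J"
    and m: "m \<in> multiples B {c}" "m \<in> multiples B' {c'}" for c B c' B' m
  proof -
    obtain A A' where g: "gen A B c" "gen A' B' c'" using J by (auto simp: J_def)
    then have AB: "(A, B) \<in> F" "(A', B') \<in> F" and c: "Poly_Mapping.keys c \<subseteq> ?N" "Poly_Mapping.keys c' \<subseteq> ?N"
      unfolding gen_def by blast+
    have eq: "A = A'" "B = B'"
      using interval_partition_disjoint[OF F AB] interval[OF g(1) m(1)] interval[OF g(2) m(2)] by blast+
    \<comment> \<open>On \<open>B\<close> the generator is determined by the interval, off
      \<open>B\<close> it agrees with \<open>m\<close>.\<close>
    have "Poly_Mapping.lookup c i = Poly_Mapping.lookup c' i" for i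
    proof (cases "i \<in> B")
      case True
      then have "i \<in> ?N" using F_sub[OF AB(1)] by blast
      then show ?thesis
        using gen_lookup[OF g(1), of i] gen_lookup[OF g(2), of i] True eq by (simp split: if_splits)
    next
      case False
      then show ?thesis using m eq unfolding multiples_single_iff by metis
    qed
    then show ?thesis using eq by (simp add: poly_mapping_eqI)
  qed
  define D where "D = map (\<lambda>(c, B). (mono c :: 'k mpoly, B)) xs"
  have spaces: "map (\<lambda>(u, Z). gen_space (*) u Z) D = map supported_in (map (\<lambda>(c, B). multiples B {c}) xs)"
    by (simp add: D_def case_prod_beta gen_space_mono)
  have "is_direct_sum (supported_in ?U :: 'k mpoly set) (map supported_in (map (\<lambda>(c, B). multiples B {c}) xs))"
  proof (rule is_direct_sum_supported_in)
    fix m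
    show "m \<in> ?U \<longleftrightarrow> (\<exists>i<length (map (\<lambda>(c, B). multiples B {c}) xs). m \<in> map (\<lambda>(c, B). multiples B {c}) xs ! i)"
      unfolding cover xs(1)[symmetric] by (auto simp: in_set_conv_nth case_prod_beta Bex_def) force+
  next
    fix i j m
    assume ij: "i < length (map (\<lambda>(c, B). multiples B {c}) xs)" "j < length (map (\<lambda>(c, B). multiples B {c}) xs)"
      and "m \<in> map (\<lambda>(c, B). multiples B {c}) xs ! i" "m \<in> map (\<lambda>(c, B). multiples B {c}) xs ! j"
    then have m: "m \<in> multiples (snd (xs ! i)) {fst (xs ! i)}" "m \<in> multiples (snd (xs ! j)) {fst (xs ! j)}"
      by (simp_all add: case_prod_beta)
    have "xs ! i \<in> J" "xs ! j \<in> J" using ij unfolding xs(1)[symmetric] by simp_all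
    then have "xs ! i = xs ! j"
      using disj[of "fst (xs ! i)" "snd (xs ! i)" "fst (xs ! j)" "snd (xs ! j)" m] m by (simp add: prod_eq_iff)
    then show "i = j" using xs(2) ij by (simp add: nth_eq_iff_index_eq)
  qed
  moreover have "mono c \<in> (supported_in ?U :: 'k mpoly set) \<and> B \<subseteq> ?N \<and> d \<le> card B" if "(c, B) \<in> J" for c B
  proof -
    have "c \<in> multiples B {c}" using subset_multiples by blast
    then have "c \<in> ?U" using cover that by blast
    moreover have "\<exists>A. gen A B c" using that by (simp add: J_def)
    then obtain A where "(A, B) \<in> F" unfolding gen_def by blast
    ultimately show ?thesis using F_sub by (simp only: mono_in_supported_in simp_thms)
  qed
  ultimately have "is_stanley_decomposition n (*) std_component (supported_in ?U) D"
    and "\<forall>(u, Z)\<in>set D. d \<le> card Z"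
    unfolding is_stanley_decomposition_def spaces
    by (auto simp: D_def xs(1) homogeneous_mono is_stanley_space_mono)
  then show ?thesis by blast
qed

section \<open>Upper bound by double counting\<close>

text \<open>Counts triples \<open>((i, j), b)\<close>: each pair has at least \<open>d - 2\<close>
  good \<open>b\<close>, while at most half of all triples are good, with \<open>n - 2\<close>
  choices of \<open>b\<close> per pair.\<close>

lemma stanley_decomposition_bound:
  fixes D :: "('k::field mpoly \<times> nat set) list"
  assumes D: "is_stanley_decomposition n (*) std_component (supported_in
      {m. Poly_Mapping.keys m \<subseteq> {1..n} \<and> large_exponents n a m \<inter> T \<noteq> {} \<and> large_exponents n a m \<inter> T' \<noteq> {}}) D"
    and T: "T \<noteq> {}" "T' \<noteq> {}" "T \<inter> T' = {}" "T \<union> T' = {1..n}"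
    and a: "\<forall>i\<in>{1..n}. 1 \<le> a i"
  shows "D \<noteq> []" and "2 * sdepth_decomposition D \<le> n + 2"
proof -
  let ?N = "{1..n}"
  let ?U = "{m. Poly_Mapping.keys m \<subseteq> ?N \<and> large_exponents n a m \<inter> T \<noteq> {} \<and> large_exponents n a m \<inter> T' \<noteq> {}}"
  have fin: "finite T" "finite T'" using T(4) by (metis finite_Un finite_atLeastAtMost)+
  define W where "W k = multiples (snd (D ! k)) (Poly_Mapping.keys (fst (D ! k)))" for k
  have mem: "fst (D ! k) \<in> supported_in ?U" "homogeneous std_component (fst (D ! k))" "snd (D ! k) \<subseteq> ?N"
    if "k < length D" for k
    using D nth_mem[OF that] unfolding is_stanley_decomposition_def by (auto simp: case_prod_beta)
  have "map (\<lambda>(u, Z). gen_space (*) u Z) D = map supported_in (map W [0..<length D])"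
    by (rule nth_equalityI) (auto simp: case_prod_beta W_def gen_space_homogeneous mem)
  then have sum: "is_direct_sum (supported_in ?U :: 'k mpoly set) (map supported_in (map W [0..<length D]))"
    using D unfolding is_stanley_decomposition_def by metis
  have cover: "\<exists>k<length D. m \<in> W k" if "m \<in> ?U" for m
    using is_direct_sum_supported_inD(1)[OF sum that] by auto
  have unique: "k = l" if "k < length D" "l < length D" "m \<in> W k" "m \<in> W l" for k l m
    using is_direct_sum_supported_inD(2)[OF sum, of k l m] that by simp

  \<comment> \<open>The exponent vector of the product of the $x_i^{a_i}$ with
    \<open>i \<in> E\<close>.\<close>
  define e where "e E = (\<Sum>i\<in>E. Poly_Mapping.single i (a i))" for E
  have lookup_e: "Poly_Mapping.lookup (e E) i = (if i \<in> E then a i else 0)" if "finite E" for E i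
    using that by (simp add: e_def lookup_sum lookup_single when_def)
  have e_insert: "e (insert x E) = e E + Poly_Mapping.single x (a x)" if "finite E" "x \<notin> E" for x E
    using that by (simp add: e_def add.commute)
  have e_U: "e {i, j} \<in> ?U" if "i \<in> T" "j \<in> T'" for i j
  proof -
    have "i \<in> ?N" "j \<in> ?N" using T(4) that by blast+
    then have "Poly_Mapping.keys (e {i, j}) \<subseteq> ?N" "{i, j} \<subseteq> large_exponents n a (e {i, j})"
      by (auto simp: in_keys_iff lookup_e large_exponents_def split: if_splits)
    then show ?thesis using that by blast
  qed
  \<comment> \<open>Both products are divisible by the generator of the space, which lies in the
    ideal and so has a large exponent on either side. Large exponents are positive by
    \<open>1 \<le> a i\<close>, so their indices belong to \<open>E\<close> and to
    \<open>E'\<close>.\<close>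
  have common: "E \<inter> E' \<inter> T \<noteq> {} \<and> E \<inter> E' \<inter> T' \<noteq> {}"
    if k: "k < length D" "e E \<in> W k" "e E' \<in> W k" and E: "finite E" "finite E'" for k E E'
  proof -
    obtain c where c: "Poly_Mapping.keys (fst (D ! k)) = {c}"
      using mem(2)[OF k(1)]
    proof (cases rule: homogeneous_cases)
      case 1
      then show ?thesis using k(2) by (simp add: W_def multiples_def)
    next
      case (2 c x)
      then show ?thesis using that by simp
    qed
    then have "c \<in> ?U" using mem(1)[OF k(1)] by (simp add: supported_in_def)
    then obtain l l' where l: "l \<in> large_exponents n a c" "l \<in> T" "l' \<in> large_exponents n a c" "l' \<in> T'" by blast
    have "i \<in> F" if "e F \<in> W k" "finite F" "i \<in> large_exponents n a c" for i F
    proof -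
      have "Poly_Mapping.lookup c i \<le> Poly_Mapping.lookup (e F) i"
        using that(1) unfolding W_def c multiples_single_iff by blast
      moreover have "1 \<le> Poly_Mapping.lookup c i" using that(3) a by (force simp: large_exponents_def)
      ultimately show ?thesis using lookup_e[OF that(2), of i] by (auto split: if_splits)
    qed
    then show ?thesis using l k(2,3) E by blast
  qed

  obtain i0 j0 where ij0: "i0 \<in> T" "j0 \<in> T'" using T(1,2) by blast
  show "D \<noteq> []" using cover[OF e_U[OF ij0]] by auto
  define d where "d = sdepth_decomposition D"
  have d: "d \<le> card (snd (D ! k))" if "k < length D" for k
    unfolding d_def sdepth_decomposition_def
    by (intro Min_le image_eqI[OF _ nth_mem[OF that]]) (simp_all add: case_prod_beta)

  \<comment> \<open>\<open>((i, j), b)\<close> is good if the space containing \<open>e {i, j}\<close> also contains \<open>e {i, j, b}\<close>. The involution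
    exchanging \<open>b\<close> with the element of \<open>{i, j}\<close> on its side keeps \<open>{i, j, b}\<close> and turns good into bad,
    as two pairs in the same space share an element on either side.\<close>
  define others where "others p = ?N - {fst p, snd p}" for p
  define good where "good p = {b \<in> others p. \<exists>k<length D. e {fst p, snd p} \<in> W k \<and> b \<in> snd (D ! k)}" for p
  define swap where "swap x = (case x of ((i, j), b) \<Rightarrow> if b \<in> T then ((b, j), i) else ((i, b), j))" for x
  define All where "All = Sigma (T \<times> T') others"
  define G where "G = Sigma (T \<times> T') good"
  have "finite All" using fin by (auto simp: All_def others_def)
  have "G \<subseteq> All" by (auto simp: All_def G_def good_def)
  have "inj_on swap All"
  proof (rule inj_on_inverseI)
    fix x assume "x \<in> All"
    then show "swap (swap x) = x" using T(3) by (auto simp: All_def swap_def)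
  qed
  have bad: "swap x \<in> All - G" if "x \<in> G" for x
  proof -
    obtain i j b where x: "x = ((i, j), b)" by (metis prod.exhaust)
    have ij: "i \<in> T" "j \<in> T'" and b: "b \<in> ?N" "b \<noteq> i" "b \<noteq> j" using that by (auto simp: x G_def good_def others_def)
    have "i \<noteq> j" using ij T(3) by blast
    have "swap x \<in> All" using ij b \<open>i \<noteq> j\<close> T by (auto simp: x swap_def All_def others_def)
    moreover have "swap x \<notin> G"
    proof
      assume sw: "swap x \<in> G"
      \<comment> \<open>Multiplying by a power of the variable with index \<open>y\<close> stays in
        the space, as \<open>y\<close> is one of its free directions.\<close>
      have grow: "\<exists>k<length D. e {fst p, snd p} \<in> W k \<and> e (insert y {fst p, snd p}) \<in> W k"
        if "(p, y) \<in> G" for p y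
      proof -
        have y: "y \<in> good p" "y \<notin> {fst p, snd p}" using that by (auto simp: G_def good_def others_def)
        obtain k where k: "k < length D" "e {fst p, snd p} \<in> W k" "y \<in> snd (D ! k)"
          using y(1) unfolding good_def by blast
        have "e {fst p, snd p} + Poly_Mapping.single y (a y) \<in> W k"
          using k(2) unfolding W_def by (rule multiples_add) (use k(3) in simp)
        then show ?thesis using k(1,2) e_insert[OF _ y(2)] by auto
      qed
      from grow[of "(i, j)" b] that x obtain k where
        k: "k < length D" "e {i, j} \<in> W k" "e {b, i, j} \<in> W k" by auto
      show False
      proof (cases "b \<in> T")
        case True
        then have "((b, j), i) \<in> G" using sw by (simp add: x swap_def)
        from grow[OF this] obtain l where
          l: "l < length D" "e {b, j} \<in> W l" "e {i, b, j} \<in> W l" by auto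
        \<comment> \<open>The monomial of \<open>{i, j, b}\<close> lies in both spaces, so they
          coincide; but \<open>{i, j}\<close> and \<open>{b, j}\<close> share no element of
          \<open>T\<close>.\<close>
        have "k = l" using unique[OF k(1) l(1) k(3)] l(3) by (simp add: insert_commute)
        then have "{i, j} \<inter> {b, j} \<inter> T \<noteq> {}" using common[OF k(1,2)] l(2) by blast
        then show False using ij b T(3) \<open>i \<noteq> j\<close> by blast
      next
        case False
        then have "((i, b), j) \<in> G" using sw by (simp add: x swap_def)
        from grow[OF this] obtain l where
          l: "l < length D" "e {i, b} \<in> W l" "e {j, i, b} \<in> W l" by auto
        have "k = l" using unique[OF k(1) l(1) k(3)] l(3) by (simp add: insert_commute)
        then have "{i, j} \<inter> {i, b} \<inter> T' \<noteq> {}" using common[OF k(1,2)] l(2) by blast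
        then show False using ij b T(3) \<open>i \<noteq> j\<close> by blast
      qed
    qed
    ultimately show ?thesis by blast
  qed
  \<comment> \<open>\<open>swap\<close> embeds the good triples into the bad ones.\<close>
  have "card G + card G = card G + card (swap ` G)"
    using \<open>inj_on swap All\<close> \<open>G \<subseteq> All\<close> by (simp add: card_image inj_on_subset)
  also have "\<dots> = card (G \<union> swap ` G)"
    using bad \<open>finite All\<close> \<open>G \<subseteq> All\<close> by (intro card_Un_disjoint[symmetric]) (auto intro: finite_subset)
  also have "\<dots> \<le> card All"
    using bad \<open>G \<subseteq> All\<close> \<open>finite All\<close> by (intro card_mono) auto
  finally have half: "2 * card G \<le> card All" by simp
  have "card (others p) = n - 2" if "p \<in> T \<times> T'" for p
  proof -
    have "fst p \<noteq> snd p" "{fst p, snd p} \<subseteq> ?N" using that T(3,4) by auto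
    then show ?thesis unfolding others_def by (subst card_Diff_subset) auto
  qed
  then have "card All = card (T \<times> T') * (n - 2)"
    unfolding All_def using fin by (subst card_SigmaI) (auto simp: others_def)
  moreover have "card (T \<times> T') * (d - 2) \<le> card G"
  proof -
    have "d - 2 \<le> card (good p)" if p: "p \<in> T \<times> T'" for p
    proof -
      obtain k where k: "k < length D" "e {fst p, snd p} \<in> W k"
        using cover[OF e_U[of "fst p" "snd p"]] p by auto
      \<comment> \<open>The space has at least \<open>d\<close> variables, of which at most two,
        \<open>i\<close> and \<open>j\<close>, are excluded from \<open>others p\<close>.\<close>
      have "d - 2 \<le> card (snd (D ! k)) - card {fst p, snd p}"
      proof (rule diff_le_mono2[THEN order_trans[rotated]])
        show "card {fst p, snd p} \<le> 2" by (simp add: card_insert_if)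
        show "d - 2 \<le> card (snd (D ! k)) - 2"
          by (intro diff_le_mono d k)
      qed
      also have "\<dots> \<le> card (snd (D ! k) - {fst p, snd p})"
        by (rule diff_card_le_card_Diff) simp
      also have "\<dots> \<le> card (good p)"
        using k mem(3)[OF k(1)] by (intro card_mono) (auto simp: good_def others_def)
      finally show ?thesis .
    qed
    then have "(\<Sum>p\<in>T \<times> T'. d - 2) \<le> (\<Sum>p\<in>T \<times> T'. card (good p))" by (intro sum_mono) auto
    also have "\<dots> = card G"
      unfolding G_def using fin by (subst card_SigmaI) (auto simp: good_def others_def)
    finally show ?thesis by simp
  qed
  ultimately have "card (T \<times> T') * (2 * (d - 2)) \<le> card (T \<times> T') * (n - 2)"
    using half by linarith
  moreover have "card (T \<times> T') > 0" using T fin by (simp add: card_gt_0_iff)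
  ultimately have "2 * (d - 2) \<le> n - 2" by simp
  \<comment> \<open>Differences of natural numbers are truncated; \<open>2 \<le> n\<close> allows
    passing to \<open>2 * d \<le> n + 2\<close>.\<close>
  moreover have "2 \<le> n"
  proof -
    have "{i0, j0} \<subseteq> ?N" "i0 \<noteq> j0" using ij0 T(3,4) by blast+
    then show ?thesis by auto
  qed
  ultimately show "2 * sdepth_decomposition D \<le> n + 2" unfolding d_def by simp
qed

section \<open>The depth of the intersection\<close>

theorem corollary2p9:
  fixes n t :: nat
    and Q Q' :: "'k::field mpoly set"
  assumes "odd n"
    and "1 \<le> t" and "t < n"
    and "irreducible_monomial_ideal n Q"
    and "irreducible_monomial_ideal n Q'"
    and "radical (poly_ring {1..n}) Q = Idl\<^bsub>poly_ring {1..n}\<^esub> (X ` {1..t})"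
    and "radical (poly_ring {1..n}) Q' = Idl\<^bsub>poly_ring {1..n}\<^esub> (X ` {t+1..n})"
  shows "int (sdepth_ideal n (Q \<inter> Q')) = \<lceil>real n / 2\<rceil>"
proof -
  let ?T = "{1..t}" and ?T' = "{t+1..n}"
  have sub: "?T \<subseteq> {1..n}" "?T' \<subseteq> {1..n}" using assms(2,3) by auto
  obtain a1 where a1: "\<forall>i\<in>?T. 1 \<le> a1 i"
    "Q = supported_in {m. Poly_Mapping.keys m \<subseteq> {1..n} \<and> (\<exists>i\<in>?T. a1 i \<le> Poly_Mapping.lookup m i)}"
    using irreducible_monomial_ideal_powers[OF assms(4,6) sub(1)] by (elim exE conjE)
  obtain a2 where a2: "\<forall>i\<in>?T'. 1 \<le> a2 i"
    "Q' = supported_in {m. Poly_Mapping.keys m \<subseteq> {1..n} \<and> (\<exists>i\<in>?T'. a2 i \<le> Poly_Mapping.lookup m i)}"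
    using irreducible_monomial_ideal_powers[OF assms(5,7) sub(2)] by (elim exE conjE)
  \<comment> \<open>One exponent function serves both ideals, as their generators involve disjoint
    sets of variables.\<close>
  define a where "a i = (if i \<le> t then a1 i else a2 i)" for i
  have a: "\<forall>i\<in>{1..n}. 1 \<le> a i" using a1(1) a2(1) by (simp add: a_def)
  have TT': "?T \<noteq> {}" "?T' \<noteq> {}" "?T \<inter> ?T' = {}" "?T \<union> ?T' = {1..n}"
    using assms(2,3) by auto
  let ?U = "{m. Poly_Mapping.keys m \<subseteq> {1..n} \<and>
    large_exponents n a m \<inter> ?T \<noteq> {} \<and> large_exponents n a m \<inter> ?T' \<noteq> {}}"
  have hit: "large_exponents n a m \<inter> R \<noteq> {} \<longleftrightarrow> (\<exists>i\<in>R. a i \<le> Poly_Mapping.lookup m i)" if "R \<subseteq> {1..n}" for R m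
    using that unfolding large_exponents_def by blast
  have "large_exponents n a m \<inter> ?T \<noteq> {} \<longleftrightarrow> (\<exists>i\<in>?T. a1 i \<le> Poly_Mapping.lookup m i)"
    "large_exponents n a m \<inter> ?T' \<noteq> {} \<longleftrightarrow> (\<exists>i\<in>?T'. a2 i \<le> Poly_Mapping.lookup m i)" for m
    unfolding hit[OF sub(1)] hit[OF sub(2)] by (intro bex_cong; simp add: a_def)+
  then have QQ': "Q \<inter> Q' = supported_in ?U"
    unfolding a1(2) a2(2) supported_in_Int by (intro arg_cong[of _ _ supported_in]) auto
  let ?dec = "is_stanley_decomposition n (*) (std_component :: (nat \<Rightarrow> int) \<Rightarrow> 'k mpoly set) (supported_in ?U)"
  define h where "h = (n + 1) div 2"

  \<comment> \<open>As \<open>n + 2\<close> is odd, \<open>2 * d \<le> n + 2\<close> sharpens to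
    \<open>2 * d \<le> n + 1\<close>.\<close>
  have upper: "D \<noteq> [] \<and> sdepth_decomposition D \<le> h" if D: "?dec D" for D
    using stanley_decomposition_bound[OF D TT' a] \<open>odd n\<close> unfolding h_def by (auto elim!: oddE)
  obtain F F' where "interval_partition ((t + 1) div 2) {C. C \<subseteq> ?T \<and> C \<noteq> {}} F"
    "interval_partition ((n - t + 1) div 2) {C. C \<subseteq> ?T' \<and> C \<noteq> {}} F'"
    using interval_partition_nonempty_subsets[of ?T] interval_partition_nonempty_subsets[of ?T'] by auto
  from interval_partition_product[OF this] TT'(3)
  obtain FF where FF: "interval_partition ((t + 1) div 2 + (n - t + 1) div 2)
      {C. C \<subseteq> {1..n} \<and> C \<inter> ?T \<noteq> {} \<and> C \<inter> ?T' \<noteq> {}} FF"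
    unfolding TT'(4) by auto
  have "{C. C \<subseteq> {1..n} \<and> C \<inter> ?T \<noteq> {} \<and> C \<inter> ?T' \<noteq> {}} \<subseteq> Pow {1..n}" by blast
  from ex_stanley_decomposition[OF FF this a, where ?'k = 'k] obtain D where
    "is_stanley_decomposition n (*) (std_component :: (nat \<Rightarrow> int) \<Rightarrow> 'k mpoly set) (supported_in
      {m. Poly_Mapping.keys m \<subseteq> {1..n} \<and>
        large_exponents n a m \<in> {C. C \<subseteq> {1..n} \<and> C \<inter> ?T \<noteq> {} \<and> C \<inter> ?T' \<noteq> {}}}) D"
    and large: "\<forall>(u, Z)\<in>set D. (t + 1) div 2 + (n - t + 1) div 2 \<le> card Z" by (elim exE conjE)
  moreover have "large_exponents n a m \<subseteq> {1..n}" for m by (auto simp: large_exponents_def)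
  ultimately have D: "?dec D" by (simp only: mem_Collect_eq simp_thms)
  \<comment> \<open>Exactly one of \<open>t\<close> and \<open>n - t\<close> is odd, so rounding up
    both halves adds 1/2 in total, just as rounding up \<open>n / 2\<close> does.\<close>
  have "h = (t + 1) div 2 + (n - t + 1) div 2"
  proof -
    obtain r where "n = t + r" using assms(3) less_imp_add_positive by blast
    then show ?thesis using assms(1) unfolding h_def by (cases "even t") (auto elim!: evenE oddE)
  qed
  \<comment> \<open>The minimum is taken over a nonempty set, since \<open>upper\<close> excludes
    the empty decomposition.\<close>
  then have "h \<le> sdepth_decomposition D"
    unfolding sdepth_decomposition_def using upper[OF D] large by (intro Min.boundedI) auto
  then have eq: "sdepth_decomposition D = h" using upper[OF D] by simp
  have "sdepth_ideal n (Q \<inter> Q') = h"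
    unfolding sdepth_ideal_def sdepth_def QQ'
  proof (rule Max_eqI)
    \<comment> \<open>\<open>Max\<close> needs a finite set of depths, which the upper bound
      provides.\<close>
    have "{sdepth_decomposition D |D. ?dec D} \<subseteq> {..h}" using upper by auto
    then show "finite {sdepth_decomposition D |D. ?dec D}" using finite_subset by blast
  qed (use upper D eq in auto)
  moreover have "\<lceil>real n / 2\<rceil> = int h"
    using assms(1) unfolding h_def by (auto elim!: oddE simp: ceiling_eq_iff)
  ultimately show ?thesis by simp
qed

end
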